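(* Let $\alpha<0$, let $I\subset\mathbb{R}$ be a bounded time interval containing $0$, and let $\epsilon>0$. Let $S_{\alpha,0}(t)=e^{it(\partial_y^2+\alpha\partial_x^4)}$ be the linear group on $\mathbb{T}^2$. Then there exists a positive constant $C$ (which may depend on $\alpha$, $I$ and $\epsilon$) such that $$\|D_{x,y}^{-\frac18-\epsilon}S_{\alpha,0}(t)\phi\|_{L^4(I\times\mathbb{T}^2)}\le C\,\|\phi\|_{L^2(\mathbb{T}^2)}$$ for every $\phi\in L^2(\mathbb{T}^2)$.
   Context: $\mathbb{T}=\mathbb{R}/2\pi\mathbb{Z}$; points of $\mathbb{T}^2$ are $(x,y)$ with dual variables $(n_1,n_2)\in\mathbb{Z}^2$. The group is given by $[S_{\alpha,0}(t)f]^\wedge(n_1,n_2)=e^{-it(-\alpha n_1^4+n_2^2)}\widehat f(n_1,n_2)$. For $\sigma>0$, $D_{x,y}^{-\sigma}$ denotes the operator of "loss of $\sigma$ derivatives", i.e. the Fourier multiplier $[D_{x,y}^{-\sigma}f]^\wedge(n_1,n_2)=(1+|n_1|+|n_2|)^{-\sigma}\widehat f(n_1,n_2)$. *)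

theory Defs
  imports "HOL-Analysis.Analysis"
begin

text \<open>
  The torus \<open>(\<real> / 2\<pi>\<int>)\<^sup>2\<close> enters only as a measure space, so it is identified with the
  fundamental domain \<open>[0, 2\<pi>)\<^sup>2\<close> carrying (non-normalised) Lebesgue measure. Elements of
  Lebesgue spaces are given by Borel measurable representatives; every class has one.
\<close>

definition torus2 :: "(real \<times> real) measure" where
  "torus2 = restrict_space lborel ({0..<2 * pi} \<times> {0..<2 * pi})"

definition spacetime :: "real set \<Rightarrow> (real \<times> (real \<times> real)) measure" where
  "spacetime I = restrict_space lborel I \<Otimes>\<^sub>M torus2"

definition Lp_space :: "real \<Rightarrow> 'a measure \<Rightarrow> ('a \<Rightarrow> complex) set" where
  "Lp_space p M = {f \<in> borel_measurable M. integrable M (\<lambda>z. norm (f z) powr p)}"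

text \<open>The Bochner integral is 0 for non-integrable functions, so \<open>Lp_norm p M f\<close> is the
  \<open>L\<^sup>p\<close> norm only for \<open>f \<in> Lp_space p M\<close>.\<close>

definition Lp_norm :: "real \<Rightarrow> 'a measure \<Rightarrow> ('a \<Rightarrow> complex) \<Rightarrow> real" where
  "Lp_norm p M f = (LINT z|M. norm (f z) powr p) powr (1 / p)"

definition fourier_coeff :: "(real \<times> real \<Rightarrow> complex) \<Rightarrow> int \<Rightarrow> int \<Rightarrow> complex" where
  "fourier_coeff f n1 n2 =
     (LINT z|torus2. f z * exp (- \<i> * complex_of_real (of_int n1 * fst z + of_int n2 * snd z)))
       / complex_of_real ((2 * pi)\<^sup>2)"

text \<open>
  Operators on \<open>L\<^sup>2\<close> given by a Fourier multiplier \<open>m\<close> are expressed as relations between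
  representatives: \<open>g\<close> is a representative of the image of \<open>f\<close>. For bounded \<open>m\<close> and
  \<open>f \<in> L\<^sup>2\<close> such a \<open>g\<close> exists and is unique up to null sets.
\<close>

definition is_multiplier_image ::
  "(int \<Rightarrow> int \<Rightarrow> complex) \<Rightarrow> (real \<times> real \<Rightarrow> complex) \<Rightarrow> (real \<times> real \<Rightarrow> complex) \<Rightarrow> bool" where
  "is_multiplier_image m f g \<longleftrightarrow>
     g \<in> Lp_space 2 torus2 \<and> (\<forall>n1 n2. fourier_coeff g n1 n2 = m n1 n2 * fourier_coeff f n1 n2)"

definition is_D_loss ::
  "real \<Rightarrow> (real \<times> real \<Rightarrow> complex) \<Rightarrow> (real \<times> real \<Rightarrow> complex) \<Rightarrow> bool" where
  "is_D_loss \<sigma> = is_multiplier_image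
     (\<lambda>n1 n2. complex_of_real ((1 + \<bar>of_int n1\<bar> + \<bar>of_int n2\<bar>) powr (- \<sigma>)))"

definition is_S_flow ::
  "real \<Rightarrow> real \<Rightarrow> (real \<times> real \<Rightarrow> complex) \<Rightarrow> (real \<times> real \<Rightarrow> complex) \<Rightarrow> bool" where
  "is_S_flow \<alpha> t = is_multiplier_image
     (\<lambda>n1 n2. exp (- \<i> * complex_of_real (t * (- \<alpha> * of_int n1 ^ 4 + (of_int n2)\<^sup>2))))"

text \<open>
  \<open>u\<close> is a jointly measurable function on \<open>I \<times> \<bbbT>\<^sup>2\<close> representing
  \<open>t \<mapsto> D\<^sup>-\<^sup>\<sigma> S(t) \<phi>\<close>. Joint measurability has to be demanded, since choosing a
  representative separately for each \<open>t\<close> does not guarantee it; two such \<open>u\<close> agree almost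
  everywhere on \<open>I \<times> \<bbbT>\<^sup>2\<close>.
\<close>

definition represents_D_loss_S_flow ::
  "real \<Rightarrow> real \<Rightarrow> real set \<Rightarrow> (real \<times> real \<Rightarrow> complex) \<Rightarrow>
     (real \<times> (real \<times> real) \<Rightarrow> complex) \<Rightarrow> bool" where
  "represents_D_loss_S_flow \<sigma> \<alpha> I \<phi> u \<longleftrightarrow>
     u \<in> borel_measurable (spacetime I) \<and>
     (\<forall>t\<in>I. \<exists>v. is_S_flow \<alpha> t \<phi> v \<and> is_D_loss \<sigma> v (\<lambda>z. u (t, z)))"

end

theory Submission imports Defs begin

text \<open>
  Squaring turns the \<open>L\<^sup>4\<close> norm into the \<open>L\<^sup>2\<close> norm of \<open>u\<^sup>2\<close>, whose Fourier coefficient at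
  \<open>k\<close> is the exponential sum in time with frequencies \<open>\<omega>(m) + \<omega>(k - m)\<close>, where
  \<open>\<omega>(n) = -\<alpha> n\<^sub>1^4 + n\<^sub>2^2\<close>. On a bounded time interval such a sum is almost orthogonal up to the
  largest number of frequencies in a unit window. For \<open>|m|, |k - m| \<le> N\<close> this number is
  \<open>O(N^{1/2})\<close>: with \<open>p = 2 m\<^sub>1 - k\<^sub>1\<close> and \<open>q = 2 m\<^sub>2 - k\<^sub>2\<close> the window fixes \<open>q\<close> up to sign once
  \<open>p\<close> is known, and since \<open>q\<^sup>2 = O(N\<^sup>2)\<close> the quartic growth in \<open>p\<close> confines \<open>|p|\<close> to an interval of
  length \<open>O(N^{1/2})\<close>. This loses \<open>N^{1/8}\<close> on frequencies of size \<open>N\<close>, and the factor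
  \<open>N^{-\<epsilon>}\<close> makes the dyadic pieces summable. Completeness of the characters (Stone-Weierstrass)
  identifies every representative with the limit of its partial sums, and Fatou's lemma
  concludes.
\<close>

section \<open>Characters and Fourier coefficients on the torus\<close>

text \<open>A sharp time cutoff would give a kernel decaying only like 1/|delta| in the frequency
  gap, which is not summable over unit windows. The weight L^2 - t^2 vanishes at both ends of a
  larger interval, and this yields decay 1/delta^2.

  The multiplier relations speak of arbitrary representatives \<open>u\<close>, known only through
  the Fourier coefficients of their slices. The bound therefore needs a uniqueness theorem for
  integrable functions; since [0, 2 pi)^2 is not compact, approximation takes place on the product
  of two unit circles. Existence of a jointly measurable \<open>u\<close> needs one sequence of
  partial sums that converges almost everywhere for every t. It is chosen from the coefficients of
  the initial datum alone: the multipliers at all times have modulus at most 1, so the same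
  frequency sets give fast convergence for each t.

  All estimates concern nonnegative integrals of finite trigonometric sums. Dyadic pieces are
  recombined pointwise, by Hoelder with geometric weights, rather than by the triangle inequality in
  L^4.\<close>

definition tchar :: "int \<times> int \<Rightarrow> real \<times> real \<Rightarrow> complex" where
  "tchar n z = cis (of_int (fst n) * fst z + of_int (snd n) * snd z)"

definition trig_poly :: "(int \<times> int \<Rightarrow> complex) \<Rightarrow> (int \<times> int) set \<Rightarrow> real \<times> real \<Rightarrow> complex" where
  "trig_poly c F z = (\<Sum>n\<in>F. c n * tchar n z)"

abbreviation tcoeff :: "(real \<times> real \<Rightarrow> complex) \<Rightarrow> int \<times> int \<Rightarrow> complex" where
  "tcoeff f n \<equiv> fourier_coeff f (fst n) (snd n)"

lemma tchar_add: "tchar (m + n) z = tchar m z * tchar n z"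
  by (simp add: tchar_def cis_mult algebra_simps)

lemma cnj_tchar: "cnj (tchar n z) = tchar (- n) z"
  by (simp add: tchar_def cis_cnj)

lemma norm_tchar [simp]: "norm (tchar n z) = 1"
  by (simp add: tchar_def)

lemma tchar_0 [simp]: "tchar 0 z = 1"
  by (simp add: tchar_def)

lemma cis_borel_measurable [measurable]: "cis \<in> borel_measurable borel"
  unfolding cis_conv_exp by (intro borel_measurable_continuous_onI continuous_intros)

lemma cnj_borel_measurable [measurable]: "cnj \<in> borel_measurable borel"
  by (intro borel_measurable_continuous_onI continuous_intros)

lemma tchar_measurable [measurable]: "tchar n \<in> borel_measurable borel"
  unfolding tchar_def cis_conv_exp
  by (intro borel_measurable_continuous_onI continuous_intros)

lemma norm_trig_poly_le: "norm (trig_poly c F z) \<le> (\<Sum>n\<in>F. norm (c n))"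
  unfolding trig_poly_def by (rule sum_norm_le) (simp add: norm_mult)

lemma trig_poly_measurable [measurable]: "trig_poly c F \<in> borel_measurable borel"
  unfolding trig_poly_def by measurable

section \<open>The fundamental domain as a finite measure space\<close>

lemma space_torus2: "space torus2 = {0..<2 * pi} \<times> {0..<2 * pi}"
  by (simp add: torus2_def space_restrict_space)

lemma sets_torus2: "sets torus2 = sets (restrict_space borel ({0..<2 * pi} \<times> {0..<2 * pi}))"
  unfolding torus2_def by (rule sets_restrict_space_cong) simp

lemma measurable_torus2I: "f \<in> measurable borel N \<Longrightarrow> f \<in> measurable torus2 N"
  unfolding torus2_def by (rule measurable_restrict_space1) simp

lemma tchar_measurable_torus2 [measurable]: "tchar n \<in> borel_measurable torus2"
  by (rule measurable_torus2I) measurable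

lemma trig_poly_measurable_torus2 [measurable]: "trig_poly c F \<in> borel_measurable torus2"
  by (rule measurable_torus2I) measurable

lemma square_Ico_borel [measurable]: "{0..<2 * pi} \<times> {0..<2 * pi} \<in> sets borel"
proof -
  have "{0..<2 * pi} \<times> {0..<2 * pi} \<in> sets (borel \<Otimes>\<^sub>M borel)"
    by (rule pair_measureI) auto
  then show ?thesis unfolding borel_prod .
qed

lemma finite_measure_torus2: "finite_measure torus2"
proof
  have "emeasure torus2 (space torus2) = emeasure lborel ({0..<2 * pi} \<times> {0..<2 * pi})"
    using square_Ico_borel unfolding torus2_def
    by (subst emeasure_restrict_space) (auto simp: space_restrict_space)
  also have "\<dots> = emeasure (lborel \<Otimes>\<^sub>M lborel) ({0..<2 * pi} \<times> {0..<2 * pi})"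
    by (simp add: lborel_prod)
  also have "\<dots> = emeasure lborel {0..<2 * pi} * emeasure lborel {0..<2 * pi}"
    by (rule lborel.emeasure_pair_measure_Times) auto
  also have "\<dots> \<noteq> \<infinity>" by (simp add: ennreal_mult_eq_top_iff)
  finally show "emeasure torus2 (space torus2) \<noteq> \<infinity>" .
qed

interpretation torus2: finite_measure torus2
  by (rule finite_measure_torus2)

lemma integral_cis_period:
  "(LINT x|lborel. indicator {0..<2 * pi} x *\<^sub>R cis (of_int n * x)) = (if n = 0 then 2 * pi else 0)"
proof -
  \<comment> \<open>The half-open period is closed up at the null point 2 pi, so that the
    fundamental theorem of calculus applies.\<close>
  have ae: "AE x in lborel. x \<noteq> 2 * pi"
    by (rule AE_lborel_singleton)
  have "(LINT x|lborel. indicator {0..<2 * pi} x *\<^sub>R cis (of_int n * x))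
      = (LINT x|lborel. indicator {0..2 * pi} x *\<^sub>R cis (of_int n * x))"
    by (rule integral_cong_AE, measurable) (use ae in \<open>auto simp: indicator_def\<close>)
  also have "\<dots> = (if n = 0 then 2 * pi else 0)"
  proof (cases "n = 0")
    case True
    then show ?thesis by (simp add: scaleR_conv_of_real)
  next
    case False
    define F where "F x = cis (of_int n * x) / (\<i> * of_int n)" for x
    have "(LINT x|lborel. indicator {0..2 * pi} x *\<^sub>R cis (of_int n * x)) = F (2 * pi) - F 0"
    proof (rule integral_FTC_Icc)
      fix x :: real
      have "(F has_vector_derivative (of_int n * (\<i> * cis (of_int n * x))) / (\<i> * of_int n)) (at x within {0..2*pi})"
        unfolding F_def
        using False
        by (auto intro!: derivative_eq_intros
            simp: has_vector_derivative_def fun_eq_iff scaleR_conv_of_real field_simps)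
      then show "(F has_vector_derivative cis (of_int n * x)) (at x within {0..2*pi})"
        using False by (simp add: field_simps)
    qed (auto intro!: continuous_intros)
    also have "F (2 * pi) = F 0"
      unfolding F_def using cis_multiple_2pi[of "of_int n"] by (simp add: mult.commute)
    finally show ?thesis using False by simp
  qed
  finally show ?thesis .
qed

lemma integrable_bounded_torus2:
  fixes f :: "real \<times> real \<Rightarrow> 'b::{banach, second_countable_topology}"
  assumes "f \<in> borel_measurable torus2" "\<And>z. norm (f z) \<le> K"
  shows "integrable torus2 f"
  by (rule torus2.integrable_const_bound[where B=K]) (use assms in auto)

lemma integrable_trig_poly [simp]: "integrable torus2 (trig_poly c F)"
  by (rule integrable_bounded_torus2[where K="\<Sum>n\<in>F. norm (c n)"]) (auto intro: norm_trig_poly_le)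

lemma integrable_tchar [simp]: "integrable torus2 (tchar n)"
  by (rule integrable_bounded_torus2[where K=1]) auto

lemma integral_tchar: "integral\<^sup>L torus2 (tchar n) = (if n = 0 then (2 * pi)\<^sup>2 else 0)"
proof -
  let ?S = "{0..<2 * pi} \<times> {0..<2 * pi}"
  let ?h = "\<lambda>k x. indicator {0..<2 * pi} x *\<^sub>R cis (of_int k * x) :: complex"
  have "integrable lborel (\<lambda>z. indicator ?S z *\<^sub>R tchar n z)"
    using integrable_tchar[of n] unfolding torus2_def
    by (subst (asm) integrable_restrict_space) (auto simp: set_integrable_def)
  then have int: "integrable (lborel \<Otimes>\<^sub>M lborel) (\<lambda>z. indicator ?S z *\<^sub>R tchar n z)"
    by (simp add: lborel_prod)
  have "integral\<^sup>L torus2 (tchar n) = (LINT z|lborel. indicator ?S z *\<^sub>R tchar n z)"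
    unfolding torus2_def by (subst integral_restrict_space) auto
  also have "\<dots> = (LINT z|(lborel \<Otimes>\<^sub>M lborel). indicator ?S z *\<^sub>R tchar n z)"
    by (simp add: lborel_prod)
  also have "\<dots> = (LINT x|lborel. LINT y|lborel. indicator ?S (x, y) *\<^sub>R tchar n (x, y))"
    by (rule lborel_pair.integral_fst'[OF int, symmetric])
  also have "\<dots> = (LINT x|lborel. LINT y|lborel. ?h (fst n) x * ?h (snd n) y)"
    by (intro Bochner_Integration.integral_cong refl)
       (auto simp: tchar_def cis_mult indicator_def)
  also have "\<dots> = (LINT x|lborel. ?h (fst n) x) * (LINT y|lborel. ?h (snd n) y)"
    by (simp only: integral_mult_left_zero integral_mult_right_zero)
  also have "\<dots> = (if n = 0 then (2 * pi)\<^sup>2 else 0)"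
    unfolding integral_cis_period by (auto simp: prod_eq_iff power2_eq_square)
  finally show ?thesis .
qed

lemma tcoeff_altdef: "tcoeff f n = (LINT z|torus2. f z * cnj (tchar n z)) / complex_of_real ((2 * pi)\<^sup>2)"
proof -
  have "exp (- \<i> * complex_of_real x) = cnj (cis x)" for x
    by (metis cis_cnj cis_conv_exp mult_minus_right mult_minus_left of_real_minus)
  then show ?thesis unfolding fourier_coeff_def tchar_def by (simp only:)
qed

lemma integral_mult_cnj_tchar: "(LINT z|torus2. f z * cnj (tchar n z)) = (2 * pi)\<^sup>2 * tcoeff f n"
  by (simp add: tcoeff_altdef)

lemma integral_tchar_mult_cnj:
  "(LINT z|torus2. tchar m z * cnj (tchar n z)) = (if m = n then (2 * pi)\<^sup>2 else 0)"
proof -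
  have "(LINT z|torus2. tchar m z * cnj (tchar n z)) = integral\<^sup>L torus2 (tchar (m - n))"
    by (intro Bochner_Integration.integral_cong refl) (simp add: cnj_tchar flip: tchar_add)
  then show ?thesis by (simp add: integral_tchar)
qed

lemma tcoeff_trig_poly:
  assumes "finite F"
  shows "tcoeff (trig_poly c F) n = (if n \<in> F then c n else 0)"
proof -
  have int: "integrable torus2 (\<lambda>z. tchar m z * cnj (tchar n z))" for m
    by (rule integrable_bounded_torus2[where K=1]) (auto simp: norm_mult)
  have "(LINT z|torus2. trig_poly c F z * cnj (tchar n z))
      = (LINT z|torus2. (\<Sum>m\<in>F. c m * (tchar m z * cnj (tchar n z))))"
    by (simp add: trig_poly_def sum_distrib_right mult.assoc)
  also have "\<dots> = (\<Sum>m\<in>F. c m * (LINT z|torus2. tchar m z * cnj (tchar n z)))"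
    using int by (subst Bochner_Integration.integral_sum) auto
  also have "\<dots> = (2 * pi)\<^sup>2 * (if n \<in> F then c n else 0)"
    using assms by (simp add: integral_tchar_mult_cnj if_distrib if_distribR sum.delta cong: if_cong)
  finally show ?thesis by (simp add: tcoeff_altdef)
qed

section \<open>Square integrable functions, Parseval for finite sums, Bessel's inequality\<close>

lemma Lp_space_2_iff:
  "f \<in> Lp_space 2 M \<longleftrightarrow> f \<in> borel_measurable M \<and> integrable M (\<lambda>z. (norm (f z))\<^sup>2)"
  by (simp add: Lp_space_def)

lemma trig_poly_Lp_space: "trig_poly c F \<in> Lp_space 2 torus2"
  unfolding Lp_space_2_iff
  by (auto intro!: integrable_bounded_torus2[where K="(\<Sum>n\<in>F. norm (c n))\<^sup>2"] power_mono norm_trig_poly_le)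

lemma Lp_space_2_integrable:
  assumes "f \<in> Lp_space 2 torus2"
  shows "integrable torus2 f"
proof (rule Bochner_Integration.integrable_bound)
  show "integrable torus2 (\<lambda>z. 1 + (norm (f z))\<^sup>2)"
    using assms by (intro Bochner_Integration.integrable_add) (auto simp: Lp_space_2_iff)
  \<comment> \<open>On a finite measure space this elementary bound is what puts L^2 inside
    L^1.\<close>
  have "x \<le> 1 + x\<^sup>2" for x :: real
    by (sos)
  then show "AE z in torus2. norm (f z) \<le> norm (1 + (norm (f z))\<^sup>2)"
    by auto
qed (use assms in \<open>auto simp: Lp_space_2_iff\<close>)

lemma integrable_mult_bounded:
  fixes f g :: "_ \<Rightarrow> complex"
  assumes "integrable M f" "g \<in> borel_measurable M" "\<And>z. norm (g z) \<le> K"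
  shows "integrable M (\<lambda>z. f z * g z)"
proof (rule Bochner_Integration.integrable_bound)
  show "integrable M (\<lambda>z. K * norm (f z))" using assms by auto
  have "K \<ge> 0" using assms(3)[of undefined] norm_ge_zero order_trans by blast
  then show "AE z in M. norm (f z * g z) \<le> norm (K * norm (f z))"
    using assms(3) by (auto simp: norm_mult mult.commute[of K] intro!: mult_left_mono)
qed (use assms in auto)

lemma Lp_space_2_diff:
  assumes "f \<in> Lp_space 2 M" "g \<in> Lp_space 2 M"
  shows "(\<lambda>z. f z - g z) \<in> Lp_space 2 M"
  unfolding Lp_space_2_iff
proof
  show "integrable M (\<lambda>z. (norm (f z - g z))\<^sup>2)"
  proof (rule Bochner_Integration.integrable_bound)
    show "integrable M (\<lambda>z. 2 * (norm (f z))\<^sup>2 + 2 * (norm (g z))\<^sup>2)"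
      using assms by (auto simp: Lp_space_2_iff)
    have "(norm (a - b))\<^sup>2 \<le> 2 * (norm a)\<^sup>2 + 2 * (norm b)\<^sup>2" for a b :: complex
    proof -
      have "(norm (a - b))\<^sup>2 \<le> (norm a + norm b)\<^sup>2"
        by (intro power_mono norm_triangle_ineq4) auto
      also have "\<dots> \<le> 2 * (norm a)\<^sup>2 + 2 * (norm b)\<^sup>2"
        using zero_le_power2[of "norm a - norm b"] by (simp add: power2_sum power2_diff)
      finally show ?thesis .
    qed
    then show "AE z in M. norm ((norm (f z - g z))\<^sup>2) \<le> norm (2 * (norm (f z))\<^sup>2 + 2 * (norm (g z))\<^sup>2)"
      by (intro AE_I2) (auto simp: abs_of_nonneg)
  qed (use assms in \<open>auto simp: Lp_space_2_iff\<close>)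
qed (use assms in \<open>auto simp: Lp_space_2_iff\<close>)

lemma tcoeff_diff:
  assumes "integrable torus2 f" "integrable torus2 g"
  shows "tcoeff (\<lambda>z. f z - g z) n = tcoeff f n - tcoeff g n"
proof -
  have "integrable torus2 (\<lambda>z. h z * cnj (tchar n z))" if "integrable torus2 h" for h
    by (rule integrable_mult_bounded[where K=1]) (use that in auto)
  then show ?thesis
    using assms by (simp add: tcoeff_altdef left_diff_distrib diff_divide_distrib)
qed

lemma cmod_diff_squared: "(norm (a - b))\<^sup>2 = (norm a)\<^sup>2 - 2 * Re (a * cnj b) + (norm b)\<^sup>2" for a b :: complex
  unfolding cmod_power2 by (simp add: power2_diff algebra_simps)

lemma integral_mult_cnj_trig_poly:
  assumes "integrable torus2 f"
  shows "(LINT z|torus2. f z * cnj (trig_poly c F z)) = (2 * pi)\<^sup>2 * (\<Sum>n\<in>F. tcoeff f n * cnj (c n))"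
proof -
  have int: "integrable torus2 (\<lambda>z. f z * cnj (tchar n z))" for n
    by (rule integrable_mult_bounded[where K=1]) (use assms in auto)
  have "(LINT z|torus2. f z * cnj (trig_poly c F z))
      = (LINT z|torus2. (\<Sum>n\<in>F. cnj (c n) * (f z * cnj (tchar n z))))"
    by (simp add: trig_poly_def sum_distrib_left algebra_simps)
  also have "\<dots> = (\<Sum>n\<in>F. cnj (c n) * (LINT z|torus2. f z * cnj (tchar n z)))"
    using int by (subst Bochner_Integration.integral_sum) auto
  also have "\<dots> = (2 * pi)\<^sup>2 * (\<Sum>n\<in>F. tcoeff f n * cnj (c n))"
    by (simp add: integral_mult_cnj_tchar sum_distrib_left algebra_simps)
  finally show ?thesis .
qed

lemma integral_norm_trig_poly_squared:
  assumes "finite F"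
  shows "(LINT z|torus2. (norm (trig_poly c F z))\<^sup>2) = (2 * pi)\<^sup>2 * (\<Sum>n\<in>F. (norm (c n))\<^sup>2)"
proof -
  have "complex_of_real (LINT z|torus2. (norm (trig_poly c F z))\<^sup>2)
      = (LINT z|torus2. trig_poly c F z * cnj (trig_poly c F z))"
    by (simp only: complex_norm_square[symmetric] integral_complex_of_real)
  also have "\<dots> = (2 * pi)\<^sup>2 * (\<Sum>n\<in>F. tcoeff (trig_poly c F) n * cnj (c n))"
    by (rule integral_mult_cnj_trig_poly) simp
  also have "\<dots> = (2 * pi)\<^sup>2 * (\<Sum>n\<in>F. c n * cnj (c n))"
    using assms by (simp add: tcoeff_trig_poly)
  also have "\<dots> = complex_of_real ((2 * pi)\<^sup>2 * (\<Sum>n\<in>F. (norm (c n))\<^sup>2))"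
    by (simp add: complex_norm_square[symmetric])
  finally show ?thesis unfolding of_real_eq_iff .
qed

text \<open>Pythagoras: the partial Fourier sum is the orthogonal projection of \<open>f\<close>
  onto the characters in \<open>F\<close>, so pairing \<open>f\<close> with it gives exactly its own
  squared norm. The factor (2 pi)^2 appears because Lebesgue measure is not normalised.\<close>

lemma integral_diff_trig_poly_squared:
  assumes f: "f \<in> Lp_space 2 torus2" and F: "finite F"
  shows "(LINT z|torus2. (norm (f z - trig_poly (tcoeff f) F z))\<^sup>2)
    = (LINT z|torus2. (norm (f z))\<^sup>2) - (2 * pi)\<^sup>2 * (\<Sum>n\<in>F. (norm (tcoeff f n))\<^sup>2)"
proof -
  let ?P = "trig_poly (tcoeff f) F"
  have 1: "integrable torus2 (\<lambda>z. (norm (f z))\<^sup>2)" "integrable torus2 (\<lambda>z. (norm (?P z))\<^sup>2)"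
    using f trig_poly_Lp_space by (auto simp: Lp_space_2_iff)
  have 2: "integrable torus2 (\<lambda>z. f z * cnj (?P z))"
    by (rule integrable_mult_bounded[OF Lp_space_2_integrable[OF f]])
       (auto intro!: norm_trig_poly_le)
  have "(LINT z|torus2. f z * cnj (?P z)) = complex_of_real ((2 * pi)\<^sup>2 * (\<Sum>n\<in>F. (norm (tcoeff f n))\<^sup>2))"
    by (subst integral_mult_cnj_trig_poly[OF Lp_space_2_integrable[OF f]])
       (simp add: complex_norm_square[symmetric])
  then have 3: "(LINT z|torus2. Re (f z * cnj (?P z))) = (2 * pi)\<^sup>2 * (\<Sum>n\<in>F. (norm (tcoeff f n))\<^sup>2)"
    using integral_Re[OF 2] by simp
  show ?thesis
    unfolding cmod_diff_squared using 1 integrable_Re[OF 2] F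
    by (simp add: integral_norm_trig_poly_squared 3 del: Re_complex_of_real times_complex.sel)
qed

lemma Bessel_inequality:
  assumes "f \<in> Lp_space 2 torus2" "finite F"
  shows "(2 * pi)\<^sup>2 * (\<Sum>n\<in>F. (norm (tcoeff f n))\<^sup>2) \<le> (LINT z|torus2. (norm (f z))\<^sup>2)"
proof -
  have "0 \<le> (LINT z|torus2. (norm (f z - trig_poly (tcoeff f) F z))\<^sup>2)"
    by (rule integral_nonneg_AE) auto
  then show ?thesis by (simp only: integral_diff_trig_poly_squared[OF assms])
qed

section \<open>Uniqueness of Fourier coefficients\<close>

text \<open>The span of the characters, generated without index sets, so that closure under products
  and orthogonality to \<open>f\<close> are both plain inductions.\<close>

inductive trig_function :: "(real \<times> real \<Rightarrow> complex) \<Rightarrow> bool" where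
  char: "trig_function (\<lambda>z. a * tchar n z)"
| add: "trig_function f \<Longrightarrow> trig_function g \<Longrightarrow> trig_function (\<lambda>z. f z + g z)"

lemma trig_function_mult:
  assumes "trig_function f" "trig_function g"
  shows "trig_function (\<lambda>z. f z * g z)"
  using assms
proof (induction f)
  case (char a m)
  from char show ?case
  proof (induction g)
    case (char b n)
    have "(\<lambda>z. a * tchar m z * (b * tchar n z)) = (\<lambda>z. (a * b) * tchar (m + n) z)"
      by (simp add: tchar_add fun_eq_iff)
    then show ?case by (metis trig_function.char)
  qed (simp add: distrib_left trig_function.add)
qed (simp add: distrib_right trig_function.add)

lemma trig_function_cmult: "trig_function f \<Longrightarrow> trig_function (\<lambda>z. a * f z)"
  using trig_function_mult[of "\<lambda>z. a * tchar 0 z" f] trig_function.char[of a 0] by simp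

lemma trig_function_cos_sin:
  "trig_function (\<lambda>z. complex_of_real (cos (fst z)))"
  "trig_function (\<lambda>z. complex_of_real (sin (fst z)))"
  "trig_function (\<lambda>z. complex_of_real (cos (snd z)))"
  "trig_function (\<lambda>z. complex_of_real (sin (snd z)))"
proof -
  have 1: "trig_function (\<lambda>z. 1/2 * tchar n z + 1/2 * tchar (- n) z)"
    and 2: "trig_function (\<lambda>z. - \<i>/2 * tchar n z + \<i>/2 * tchar (- n) z)" for n
    by (intro trig_function.intros)+
  have 3: "1/2 * tchar (1,0) z + 1/2 * tchar (- (1,0)) z = complex_of_real (cos (fst z))"
    "1/2 * tchar (0,1) z + 1/2 * tchar (- (0,1)) z = complex_of_real (cos (snd z))"
    "- \<i>/2 * tchar (1,0) z + \<i>/2 * tchar (- (1,0)) z = complex_of_real (sin (fst z))"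
    "- \<i>/2 * tchar (0,1) z + \<i>/2 * tchar (- (0,1)) z = complex_of_real (sin (snd z))" for z
    by (simp_all add: tchar_def complex_eq_iff)
  show "trig_function (\<lambda>z. complex_of_real (cos (fst z)))"
    "trig_function (\<lambda>z. complex_of_real (sin (fst z)))"
    "trig_function (\<lambda>z. complex_of_real (cos (snd z)))"
    "trig_function (\<lambda>z. complex_of_real (sin (snd z)))"
    using 1[of "(1,0)"] 1[of "(0,1)"] 2[of "(1,0)"] 2[of "(0,1)"] unfolding 3 by auto
qed

text \<open>Glues the seams of the fundamental domain: the image lies in the product of two unit
  circles, a compact subset of C^2 on which Stone-Weierstrass is available.\<close>

definition torus_embed :: "real \<times> real \<Rightarrow> complex \<times> complex" where
  "torus_embed z = (cis (fst z), cis (snd z))"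

lemma torus_embed_measurable [measurable]: "torus_embed \<in> borel_measurable borel"
  unfolding torus_embed_def cis_conv_exp
  by (intro borel_measurable_continuous_onI continuous_intros)

lemma torus_embed_measurable_torus2 [measurable]: "torus_embed \<in> borel_measurable torus2"
  by (rule measurable_torus2I) measurable

text \<open>Real polynomial functions are generated by constants and real-linear functionals. On
  C^2, of real dimension 4, such a functional composed with the embedding is a combination of the
  cosines and sines of the two coordinates; sums and products stay trigonometric.\<close>

lemma trig_function_polynomial:
  assumes "real_polynomial_function p"
  shows "trig_function (\<lambda>z. complex_of_real (p (torus_embed z)))"
  using assms
proof induction
  case (linear p)
  interpret bounded_linear p by fact
  have "p (torus_embed z) = cos (fst z) * p (1, 0) + sin (fst z) * p (\<i>, 0)
      + cos (snd z) * p (0, 1) + sin (snd z) * p (0, \<i>)" for z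
  proof -
    have "torus_embed z = cos (fst z) *\<^sub>R (1, 0) + sin (fst z) *\<^sub>R (\<i>, 0)
      + cos (snd z) *\<^sub>R (0, 1) + sin (snd z) *\<^sub>R (0, \<i>)"
      by (simp add: torus_embed_def complex_eq_iff)
    then show ?thesis by (simp only: add scaleR) simp
  qed
  then have *: "(\<lambda>z. complex_of_real (p (torus_embed z))) = (\<lambda>z.
     of_real (p (1, 0)) * of_real (cos (fst z)) + of_real (p (\<i>, 0)) * of_real (sin (fst z))
      + of_real (p (0, 1)) * of_real (cos (snd z)) + of_real (p (0, \<i>)) * of_real (sin (snd z)))"
    by (simp add: fun_eq_iff mult.commute)
  show ?case unfolding *
    by (intro trig_function.add trig_function_cmult trig_function_cos_sin)
next
  case (const c)
  show ?case using trig_function.char[of "of_real c" 0] by simp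
next
  case (add f g)
  then show ?case using trig_function.add by simp
next
  case (mult f g)
  then show ?case using trig_function_mult by simp
qed

lemma trig_function_bounded_measurable:
  assumes "trig_function h"
  shows "h \<in> borel_measurable torus2 \<and> (\<exists>K. \<forall>z. norm (h z) \<le> K)"
  using assms
proof induction
  case (char a n)
  then show ?case by (auto simp: norm_mult)
next
  case (add f g)
  then obtain K L where "\<forall>z. norm (f z) \<le> K" "\<forall>z. norm (g z) \<le> L" by blast
  then have "\<forall>z. norm (f z + g z) \<le> K + L" by (meson norm_add_rule_thm norm_triangle_mono)
  with add show ?case by auto
qed

lemma integral_mult_trig_function:
  assumes f: "integrable torus2 f" and 0: "\<And>n. tcoeff f n = 0" and h: "trig_function h"
  shows "(LINT z|torus2. f z * h z) = 0"
  using h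
proof induction
  case (char a n)
  have "(LINT z|torus2. f z * tchar n z) = 0"
    using integral_mult_cnj_tchar[of f "- n"] 0[of "- n"] by (simp add: cnj_tchar)
  moreover have "(LINT z|torus2. f z * (a * tchar n z)) = a * (LINT z|torus2. f z * tchar n z)"
    by (simp add: mult.left_commute)
  ultimately show ?case by simp
next
  case (add g h)
  have "integrable torus2 (\<lambda>z. f z * g z)" if "trig_function g" for g
    using trig_function_bounded_measurable[OF that] integrable_mult_bounded[OF f, of g] by blast
  with add show ?case by (simp add: distrib_left)
qed

lemma norm_torus_embed: "norm (fst (torus_embed z)) = 1" "norm (snd (torus_embed z)) = 1"
  by (simp_all add: torus_embed_def)

text \<open>On the compact torus \<open>g\<close> is within \<open>e\<close> of a polynomial whose
  pull-back integrates to 0 against \<open>f\<close>; the remainder costs at most \<open>e\<close>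
  times the L^1 norm of \<open>f\<close>.\<close>

lemma integral_mult_continuous_eq_0:
  fixes g :: "complex \<times> complex \<Rightarrow> real"
  assumes f: "integrable torus2 f" and 0: "\<And>n. tcoeff f n = 0" and g: "continuous_on UNIV g"
  shows "(LINT z|torus2. f z * complex_of_real (g (torus_embed z))) = 0"
proof -
  let ?S = "sphere 0 1 \<times> sphere 0 1 :: (complex \<times> complex) set"
  let ?c = "LINT z|torus2. f z * complex_of_real (g (torus_embed z))"
  have S: "compact ?S" by (intro compact_Times compact_sphere)
  have E: "torus_embed z \<in> ?S" for z
    using norm_torus_embed[of z] by (simp add: mem_Times_iff)
  have g': "continuous_on ?S g" using g continuous_on_subset by blast
  have gm: "(\<lambda>z. complex_of_real (g (torus_embed z))) \<in> borel_measurable torus2"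
    using borel_measurable_continuous_onI[OF g] by measurable
  have "norm ?c \<le> e * (LINT z|torus2. norm (f z))" if "e > 0" for e
  proof -
    obtain p where p: "real_polynomial_function p" "\<And>x. x \<in> ?S \<Longrightarrow> \<bar>g x - p x\<bar> < e"
      using Stone_Weierstrass_real_polynomial_function[OF S g' \<open>e > 0\<close>] by blast
    let ?p = "\<lambda>z. complex_of_real (p (torus_embed z))"
    let ?d = "\<lambda>z. complex_of_real (g (torus_embed z)) - ?p z"
    have tp: "trig_function ?p" by (rule trig_function_polynomial) fact
    obtain K where pm: "?p \<in> borel_measurable torus2" and K: "\<And>z. norm (?p z) \<le> K"
      using trig_function_bounded_measurable[OF tp] by auto
    have d: "norm (?d z) \<le> e" for z
      using p(2)[OF E[of z]] by (simp only: of_real_diff[symmetric] norm_of_real)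
    have i1: "integrable torus2 (\<lambda>z. f z * ?p z)"
      by (rule integrable_mult_bounded[OF f pm K])
    have i2: "integrable torus2 (\<lambda>z. f z * ?d z)"
      by (rule integrable_mult_bounded[OF f _ d]) (use pm gm in measurable)
    have "?c = (LINT z|torus2. f z * ?d z + f z * ?p z)"
      by (simp add: algebra_simps)
    also have "\<dots> = (LINT z|torus2. f z * ?d z)"
      using i1 i2 integral_mult_trig_function[OF f 0 tp] by simp
    also have "norm \<dots> \<le> (LINT z|torus2. norm (f z * ?d z))"
      by (rule integral_norm_bound)
    also have "\<dots> \<le> (LINT z|torus2. e * norm (f z))"
      using integrable_norm[OF i2] integrable_norm[OF f] d
      by (intro integral_mono) (simp_all only: norm_mult mult.commute[of e] mult_left_mono norm_ge_zero integrable_mult_left)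
    finally show ?thesis by simp
  qed
  then have *: "norm ?c \<le> e * (LINT z|torus2. norm (f z))" if "e > 0" for e using that by blast
  have "((\<lambda>e. e * (LINT z|torus2. norm (f z))) \<longlongrightarrow> 0 * (LINT z|torus2. norm (f z))) (at_right 0)"
    by (intro tendsto_intros)
  then have "norm ?c \<le> 0 * (LINT z|torus2. norm (f z))"
    by (rule tendsto_lowerbound) (auto simp: eventually_at_filter * intro!: always_eventually)
  then show ?thesis by simp
qed

text \<open>The functions 1 / (1 + k dist(w, C)) are continuous and decrease to the indicator of a
  nonempty \<open>C\<close>; dominated convergence with majorant |f| transfers the
  vanishing.\<close>

lemma integral_mult_closed_eq_0:
  fixes C :: "(complex \<times> complex) set"
  assumes f: "integrable torus2 f" and 0: "\<And>n. tcoeff f n = 0" and C: "closed C"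
  shows "(LINT z|torus2. f z * indicator C (torus_embed z)) = 0"
\<comment> \<open>The empty set is split off because \<open>infdist\<close> to it is 0 by
  convention, which would make every approximant equal to 1.\<close>
proof (cases "C = {}")
  case False
  define g where "g k w = 1 / (1 + of_nat k * infdist w C)" for k :: nat and w
  have pos: "1 + of_nat k * infdist w C > (0::real)" for k :: nat and w
    by (simp add: add_pos_nonneg infdist_nonneg)
  have cont: "continuous_on UNIV (g k)" for k
    unfolding g_def using pos by (intro continuous_intros) (metis less_irrefl)
  have lim: "(\<lambda>k. g k w) \<longlonglongrightarrow> indicator C w" for w
  proof (cases "w \<in> C")
    case True
    then show ?thesis by (simp add: g_def)
  next
    case w: False
    then have "infdist w C > 0"
      using C False by (simp add: infdist_pos_not_in_closed)
    then show ?thesis using w unfolding g_def by simp real_asymp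
  qed
  have "(\<lambda>k. LINT z|torus2. f z * complex_of_real (g k (torus_embed z)))
      \<longlonglongrightarrow> (LINT z|torus2. f z * complex_of_real (indicator C (torus_embed z)))"
  proof (rule integral_dominated_convergence[where w="\<lambda>z. norm (f z)"])
    show "(\<lambda>z. f z * complex_of_real (g k (torus_embed z))) \<in> borel_measurable torus2" for k
      using f borel_measurable_continuous_onI[OF cont[of k]] by measurable
    show "(\<lambda>z. f z * complex_of_real (indicator C (torus_embed z))) \<in> borel_measurable torus2"
      using f C borel_closed[OF C] by measurable
    show "AE z in torus2. (\<lambda>k. f z * complex_of_real (g k (torus_embed z)))
        \<longlonglongrightarrow> f z * complex_of_real (indicator C (torus_embed z))"
      by (intro AE_I2 tendsto_intros lim)
    have "\<bar>g k w\<bar> \<le> 1" for k w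
      using pos[of k w] by (simp add: g_def infdist_nonneg)
    then show "AE z in torus2. norm (f z * complex_of_real (g k (torus_embed z))) \<le> norm (f z)" for k
      by (intro AE_I2) (simp only: norm_mult norm_of_real mult_left_le norm_ge_zero)
  qed (use f in auto)
  moreover have "(LINT z|torus2. f z * complex_of_real (g k (torus_embed z))) = 0" for k
    by (rule integral_mult_continuous_eq_0[OF f 0 cont])
  ultimately have "(\<lambda>k. 0) \<longlonglongrightarrow> (LINT z|torus2. f z * complex_of_real (indicator C (torus_embed z)))"
    by simp
  then have "(LINT z|torus2. f z * complex_of_real (indicator C (torus_embed z))) = 0"
    by (simp add: LIMSEQ_const_iff)
  then show ?thesis by (simp only: of_real_indicator)
qed simp

text \<open>Dynkin's argument: the closed sets are stable under intersection and generate the Borel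
  sets, and the sets with vanishing integral are stable under complements (the whole space gives 0)
  and countable disjoint unions.\<close>

lemma integral_mult_borel_eq_0:
  fixes B :: "(complex \<times> complex) set"
  assumes f: "integrable torus2 f" and 0: "\<And>n. tcoeff f n = 0" and B: "B \<in> sets borel"
  shows "(LINT z|torus2. f z * indicator B (torus_embed z)) = 0"
proof -
  let ?J = "\<lambda>B. LINT z|torus2. f z * indicator B (torus_embed z)"
  have int: "integrable torus2 (\<lambda>z. f z * indicator B (torus_embed z))" if "B \<in> sets borel" for B
    by (rule integrable_mult_bounded[OF f, where K=1])
       (use that in \<open>measurable, auto simp: indicator_def\<close>)
  have tot: "?J UNIV = 0"
    by (rule integral_mult_closed_eq_0[OF f 0]) simp
  have compl: "?J (- B) = - ?J B" if "B \<in> sets borel" for B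
  proof -
    have "?J (- B) = (LINT z|torus2. f z * indicator UNIV (torus_embed z) - f z * indicator B (torus_embed z))"
      by (intro Bochner_Integration.integral_cong refl) (auto simp: indicator_def)
    also have "\<dots> = ?J UNIV - ?J B"
      using int[of UNIV] int[OF that] by (intro Bochner_Integration.integral_diff) auto
    finally show ?thesis using tot by simp
  qed
  have "Int_stable (Collect closed :: (complex \<times> complex) set set)" "Collect closed \<subseteq> Pow (UNIV :: (complex \<times> complex) set)"
    by (auto simp: Int_stable_def)
  moreover have "B \<in> sigma_sets UNIV (Collect closed)"
    using B by (simp add: borel_eq_closed sets_measure_of)
  ultimately show ?thesis
  proof (induction rule: sigma_sets_induct_disjoint)
    case (basic A)
    then show ?case using integral_mult_closed_eq_0[OF f 0] by simp
  next
    case empty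
    show ?case by simp
  next
    case (compl A)
    then have "A \<in> sets borel" by (simp add: borel_eq_closed sets_measure_of)
    with compl \<open>\<And>B. B \<in> sets borel \<Longrightarrow> ?J (- B) = - ?J B\<close> show ?case by (simp add: Compl_eq_Diff_UNIV)
  next
    case (union A)
    have A: "A i \<in> sets borel" for i
      using union(2) by (auto simp: borel_eq_closed sets_measure_of)
    then have U: "(\<Union>i. A i) \<in> sets borel" by blast
    have "(\<lambda>k. ?J (\<Union>i<k. A i)) \<longlonglongrightarrow> ?J (\<Union>i. A i)"
    proof (rule integral_dominated_convergence[where w="\<lambda>z. norm (f z)"])
      show "AE z in torus2. (\<lambda>k. f z * indicator (\<Union>i<k. A i) (torus_embed z))
          \<longlonglongrightarrow> f z * indicator (\<Union>i. A i) (torus_embed z)"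
        by (intro AE_I2 tendsto_intros LIMSEQ_indicator_UN)
      show "(\<lambda>z. f z * indicator (\<Union>i. A i) (torus_embed z)) \<in> borel_measurable torus2"
        using int[OF U] by auto
      show "(\<lambda>z. f z * indicator (\<Union>i<k. A i) (torus_embed z)) \<in> borel_measurable torus2" for k
        using int[of "\<Union>i<k. A i"] A by auto
    qed (use f in \<open>auto simp: norm_mult indicator_def\<close>)
    moreover have "?J (\<Union>i<k. A i) = 0" for k
    proof -
      have "f z * indicator (\<Union>i<k. A i) (torus_embed z) = (\<Sum>i<k. f z * indicator (A i) (torus_embed z))" for z
      proof -
        have "indicator (\<Union>i<k. A i) (torus_embed z) = (\<Sum>i<k. indicator (A i) (torus_embed z) :: complex)"
          using union(1) by (intro indicator_UN_disjoint) (auto simp: disjoint_family_on_def)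
        then show ?thesis by (simp add: sum_distrib_left)
      qed
      then have "?J (\<Union>i<k. A i) = (LINT z|torus2. (\<Sum>i<k. f z * indicator (A i) (torus_embed z)))"
        by (simp only:)
      also have "\<dots> = (\<Sum>i<k. ?J (A i))"
        by (rule Bochner_Integration.integral_sum) (rule int[OF A])
      finally have "?J (\<Union>i<k. A i) = (\<Sum>i<k. ?J (A i))" .
      then show ?thesis using union(3) by simp
    qed
    ultimately show ?case by (simp add: LIMSEQ_const_iff)
  qed
qed

text \<open>\<open>Arg2pi\<close> is continuous off the nonnegative real axis and 0 on it; it
  therefore equals its own product with the indicator of the open complement.\<close>

lemma Arg2pi_measurable [measurable]: "Arg2pi \<in> borel_measurable borel"
proof -
  let ?S = "- {z. z \<in> \<real> \<and> 0 \<le> Re z}"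
  have S: "open ?S" 
  proof -
    have "?S = - {z. Im z = 0} \<union> - {z. 0 \<le> Re z}"
      by (auto simp: complex_is_Real_iff)
    moreover have "closed {z. Im z = 0}" "closed {z. 0 \<le> Re z}"
      by (intro closed_Collect_eq closed_Collect_le continuous_intros)+
    ultimately show ?thesis by (metis open_Compl open_Un)
  qed
  have "continuous_on ?S Arg2pi"
    by (intro continuous_at_imp_continuous_on ballI continuous_at_Arg2pi) (auto simp: complex_nonneg_Reals_iff complex_is_Real_iff)
  then have "(\<lambda>z. indicator ?S z *\<^sub>R Arg2pi z) \<in> borel_measurable borel"
    using S by (intro borel_measurable_continuous_on_indicator) auto
  moreover have "(\<lambda>z. indicator ?S z *\<^sub>R Arg2pi z) = Arg2pi"
    by (auto simp: fun_eq_iff indicator_def Arg2pi_eq_0)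
  ultimately show ?thesis by simp
qed

text \<open>Since \<open>Arg2pi\<close> inverts \<open>cis\<close> on [0, 2 pi), every Borel subset
  of the domain is the preimage of a Borel set under the embedding. Hence all integrals of
  \<open>f\<close> over measurable sets vanish.\<close>

theorem fourier_uniqueness:
  assumes f: "integrable torus2 f" and 0: "\<And>n. tcoeff f n = 0"
  shows "AE z in torus2. f z = 0"
proof (rule torus2.density_zero[OF f])
  fix A assume A: "A \<in> sets torus2"
  let ?G = "\<lambda>w :: complex \<times> complex. (Arg2pi (fst w), Arg2pi (snd w))"
  have A': "A \<in> sets borel" "A \<subseteq> {0..<2 * pi} \<times> {0..<2 * pi}"
    using A by (auto simp: sets_torus2 sets_restrict_space_iff)
  have "?G \<in> borel_measurable (borel \<Otimes>\<^sub>M borel)"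
    by measurable
  then have "?G \<in> borel_measurable borel" by (simp add: borel_prod)
  from measurable_sets[OF this A'(1)] have B: "?G -` A \<in> sets borel" by simp
  have cis: "Arg2pi (cis x) = x" if "0 \<le> x" "x < 2 * pi" for x
    by (rule Arg2pi_unique[of 1]) (use that in \<open>auto simp: cis_conv_exp\<close>)
  have "indicator A z *\<^sub>R f z = f z * indicator (?G -` A) (torus_embed z)" if "z \<in> space torus2" for z
    using that A' by (auto simp: space_torus2 torus_embed_def cis indicator_def)
  then have "set_lebesgue_integral torus2 A f = (LINT z|torus2. f z * indicator (?G -` A) (torus_embed z))"
    unfolding set_lebesgue_integral_def by (intro Bochner_Integration.integral_cong) auto
  also have "\<dots> = 0" by (rule integral_mult_borel_eq_0[OF f 0 B])
  finally show "set_lebesgue_integral torus2 A f = 0" .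
qed

section \<open>The Riesz-Fischer theorem\<close>

text \<open>Fatou's lemma, arranged so that almost everywhere convergence and a bound holding only
  eventually suffice.\<close>

lemma nn_integral_le_of_AE_tendsto:
  fixes h :: "nat \<Rightarrow> 'a \<Rightarrow> ennreal"
  assumes h: "\<And>k. h k \<in> borel_measurable M"
    and lim: "AE z in M. (\<lambda>k. h k z) \<longlonglongrightarrow> h' z"
    and B: "\<forall>\<^sub>F k in sequentially. (\<integral>\<^sup>+z. h k z \<partial>M) \<le> B"
  shows "(\<integral>\<^sup>+z. h' z \<partial>M) \<le> B"
proof -
  have "AE z in M. h' z = liminf (\<lambda>k. h k z)"
    using lim by eventually_elim (simp add: lim_imp_Liminf)
  then have "(\<integral>\<^sup>+z. h' z \<partial>M) = (\<integral>\<^sup>+z. liminf (\<lambda>k. h k z) \<partial>M)"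
    by (rule nn_integral_cong_AE)
  also have "\<dots> \<le> liminf (\<lambda>k. \<integral>\<^sup>+z. h k z \<partial>M)"
    by (rule nn_integral_liminf[OF h])
  also have "\<dots> \<le> limsup (\<lambda>k. \<integral>\<^sup>+z. h k z \<partial>M)"
    by (rule Liminf_le_Limsup) simp
  also have "\<dots> \<le> B"
    by (rule Limsup_bounded[OF B])
  finally show ?thesis .
qed

text \<open>Terms of a convergent series are eventually below 1, so the increments are eventually at
  most 2^(-j/2); they are summable and telescope.\<close>

lemma convergent_of_geometric_increments:
  fixes g :: "nat \<Rightarrow> complex"
  assumes "summable (\<lambda>j. 2 ^ j * (norm (g (Suc j) - g j))\<^sup>2)"
  shows "convergent g"
proof -
  have "(\<lambda>j. 2 ^ j * (norm (g (Suc j) - g j))\<^sup>2) \<longlonglongrightarrow> 0"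
    by (rule summable_LIMSEQ_zero[OF assms])
  then have "\<forall>\<^sub>F j in sequentially. 2 ^ j * (norm (g (Suc j) - g j))\<^sup>2 < 1"
    by (rule order_tendstoD) simp
  then have "\<forall>\<^sub>F j in sequentially. norm (g (Suc j) - g j) \<le> sqrt (1/2) ^ j"
  proof eventually_elim
    case (elim j)
    then have "(norm (g (Suc j) - g j))\<^sup>2 \<le> (1/2) ^ j"
      by (simp add: power_one_over pos_le_divide_eq mult.commute)
    also have "\<dots> = (sqrt (1/2) ^ j)\<^sup>2"
      by (simp only: power2_eq_square power_mult_distrib[symmetric] real_sqrt_mult_self)
    finally show ?case by (rule power2_le_imp_le) simp
  qed
  then have "summable (\<lambda>j. g (Suc j) - g j)"
  proof (rule summable_comparison_test_ev)
    have "norm (sqrt (1/2)) < 1" unfolding real_norm_def real_sqrt_abs by (simp only: real_sqrt_ge_zero abs_of_nonneg real_sqrt_lt_1_iff)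
    then show "summable (\<lambda>j. sqrt (1/2) ^ j)" by (rule summable_geometric)
  qed
  then have "convergent (\<lambda>n. \<Sum>j<n. g (Suc j) - g j)"
    by (simp add: summable_iff_convergent)
  then have "convergent (\<lambda>n. (g n - g 0) + g 0)"
    unfolding sum_lessThan_telescope by (intro convergent_add convergent_const)
  then show ?thesis by simp
qed

text \<open>After weighting by 2^j the integrated squared increments are still at most C 2^(-j),
  hence summable, so the weighted series is finite almost everywhere. Working with squares
  throughout avoids Minkowski's inequality.\<close>

lemma AE_convergent_L2:
  fixes g :: "nat \<Rightarrow> 'a \<Rightarrow> complex"
  assumes g [measurable]: "\<And>j. g j \<in> borel_measurable M" and C: "C \<ge> 0"
    and cauchy: "\<And>j k. j \<le> k \<Longrightarrow> (\<integral>\<^sup>+z. ennreal ((norm (g k z - g j z))\<^sup>2) \<partial>M) \<le> ennreal (C / 4 ^ j)"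
  shows "AE z in M. (\<lambda>j. g j z) \<longlonglongrightarrow> lim (\<lambda>j. g j z)"
proof -
  let ?d = "\<lambda>j z. 2 ^ j * (norm (g (Suc j) z - g j z))\<^sup>2"
  have "(\<integral>\<^sup>+z. (\<Sum>j. ennreal (?d j z)) \<partial>M) = (\<Sum>j. \<integral>\<^sup>+z. ennreal (?d j z) \<partial>M)"
    by (rule nn_integral_suminf) measurable
  also have "\<dots> \<le> (\<Sum>j. ennreal (C * (1/2) ^ j))"
  proof (intro suminf_le summableI)
    fix j
    have "(\<integral>\<^sup>+z. ennreal (?d j z) \<partial>M) = (\<integral>\<^sup>+z. ennreal (2 ^ j) * ennreal ((norm (g (Suc j) z - g j z))\<^sup>2) \<partial>M)"
      by (simp add: ennreal_mult')
    also have "\<dots> = ennreal (2 ^ j) * (\<integral>\<^sup>+z. ennreal ((norm (g (Suc j) z - g j z))\<^sup>2) \<partial>M)"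
      by (rule nn_integral_cmult) measurable
    also have "\<dots> \<le> ennreal (2 ^ j) * ennreal (C / 4 ^ j)"
      by (intro mult_left_mono cauchy) auto
    also have "\<dots> = ennreal (2 ^ j * (C / 4 ^ j))"
      using C by (intro ennreal_mult[symmetric]) auto
    also have "2 ^ j * (C / 4 ^ j) = C * (1/2) ^ j"
    proof -
      have "(4::real) ^ j = 2 ^ j * 2 ^ j" by (simp flip: power_mult_distrib)
      then show ?thesis by (simp add: power_divide)
    qed
    finally show "(\<integral>\<^sup>+z. ennreal (?d j z) \<partial>M) \<le> ennreal (C * (1/2) ^ j)" .
  qed
  also have "\<dots> = ennreal (\<Sum>j. C * (1/2) ^ j)"
    using C by (intro suminf_ennreal2) (auto intro!: summable_mult summable_geometric)
  finally have "(\<integral>\<^sup>+z. (\<Sum>j. ennreal (?d j z)) \<partial>M) \<noteq> \<infinity>"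
    by (auto simp: top_unique)
  then have "AE z in M. (\<Sum>j. ennreal (?d j z)) \<noteq> \<infinity>"
    by (intro nn_integral_noteq_infinite) measurable
  then show ?thesis
  proof (rule AE_mp, intro AE_I2 impI)
    fix z assume "(\<Sum>j. ennreal (?d j z)) \<noteq> \<infinity>"
    then have "summable (\<lambda>j. ?d j z)"
      by (intro summable_suminf_not_top) auto
    then show "(\<lambda>j. g j z) \<longlonglongrightarrow> lim (\<lambda>j. g j z)"
      by (intro convergent_LIMSEQ_iff[THEN iffD1] convergent_of_geometric_increments)
  qed
qed

text \<open>Fatou in the larger index: the Cauchy bound passes to the pointwise limit. Points of
  divergence, where \<open>lim\<close> carries no information, form a null set.\<close>

lemma L2_lim_bound:
  fixes g :: "nat \<Rightarrow> 'a \<Rightarrow> complex"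
  assumes g [measurable]: "\<And>j. g j \<in> borel_measurable M" and C: "C \<ge> 0"
    and cauchy: "\<And>j k. j \<le> k \<Longrightarrow> (\<integral>\<^sup>+z. ennreal ((norm (g k z - g j z))\<^sup>2) \<partial>M) \<le> ennreal (C / 4 ^ j)"
  shows "(\<integral>\<^sup>+z. ennreal ((norm (lim (\<lambda>j. g j z) - g j z))\<^sup>2) \<partial>M) \<le> ennreal (C / 4 ^ j)"
proof (rule nn_integral_le_of_AE_tendsto)
  have "AE z in M. (\<lambda>j. g j z) \<longlonglongrightarrow> lim (\<lambda>j. g j z)"
    by (rule AE_convergent_L2[OF g C]) (rule cauchy)
  then show "AE z in M. (\<lambda>k. ennreal ((norm (g k z - g j z))\<^sup>2)) \<longlonglongrightarrow>
      ennreal ((norm (lim (\<lambda>j. g j z) - g j z))\<^sup>2)"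
  proof eventually_elim
    case (elim z)
    then show ?case by (intro tendsto_ennrealI tendsto_intros)
  qed
  show "\<forall>\<^sub>F k in sequentially. (\<integral>\<^sup>+z. ennreal ((norm (g k z - g j z))\<^sup>2) \<partial>M) \<le> ennreal (C / 4 ^ j)"
    using cauchy by (auto simp: eventually_at_top_linorder)
qed measurable

text \<open>The rate 4^(-j) is fast enough for partial sums to converge almost everywhere. The tail
  condition involves only the moduli of \<open>a\<close>, so it passes to every coefficient family
  dominated by \<open>a\<close>, in particular to all times of the evolution at once.\<close>

definition geometric_exhaustion :: "('b \<Rightarrow> complex) \<Rightarrow> (nat \<Rightarrow> 'b set) \<Rightarrow> bool" where
  "geometric_exhaustion a F \<longleftrightarrow> (\<forall>j. finite (F j)) \<and> incseq F \<and> (\<Union>j. F j) = UNIV \<and>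
     (\<forall>j k. j \<le> k \<longrightarrow> (\<Sum>n\<in>F k - F j. (norm (a n))\<^sup>2) \<le> 1 / 4 ^ j)"

lemma geometric_exhaustion_exists:
  fixes a :: "int \<times> int \<Rightarrow> complex"
  assumes bd: "\<And>F. finite F \<Longrightarrow> (\<Sum>n\<in>F. (norm (a n))\<^sup>2) \<le> S"
  obtains F where "geometric_exhaustion a F"
proof -
  define G :: "nat \<Rightarrow> (int \<times> int) set" where "G j = {- int j..int j} \<times> {- int j..int j}" for j
  have fin: "finite (G j)" for j by (simp add: G_def)
  have mono: "G j \<subseteq> G k" if "j \<le> k" for j k using that by (auto simp: G_def)
  define s where "s j = (\<Sum>n\<in>G j. (norm (a n))\<^sup>2)" for j
  have diff: "(\<Sum>n\<in>G k - G j. (norm (a n))\<^sup>2) = s k - s j" if "j \<le> k" for j k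
    unfolding s_def by (rule sum_diff[OF fin mono[OF that]])
  have inc: "incseq s"
    unfolding s_def incseq_def by (auto intro!: sum_mono2 fin mono)
  obtain L where L: "s \<longlonglongrightarrow> L" "\<And>i. s i \<le> L"
    using incseq_convergent[OF inc, of S] bd[OF fin] unfolding s_def by blast
  have "\<exists>r. \<forall>k\<ge>r. L - s k \<le> 1 / 4 ^ j" for j
  proof -
    have "\<forall>\<^sub>F k in sequentially. s k > L - 1 / 4 ^ j"
      by (rule order_tendstoD[OF L(1)]) simp
    then show ?thesis unfolding eventually_sequentially by (force simp: algebra_simps)
  qed
  then obtain r where r: "\<And>j k. k \<ge> r j \<Longrightarrow> L - s k \<le> 1 / 4 ^ j" by metis
  \<comment> \<open>Adding all earlier thresholds makes the indices monotone, and adding j makes the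
    boxes exhaust the lattice even if the thresholds stay bounded.\<close>
  define \<rho> where "\<rho> j = j + (\<Sum>i\<le>j. r i)" for j
  have \<rho>: "\<rho> j \<ge> r j" "\<rho> j \<ge> j" for j
    by (auto simp: \<rho>_def intro: trans_le_add2 member_le_sum)
  have \<rho>_mono: "\<rho> j \<le> \<rho> k" if "j \<le> k" for j k
    using that by (auto simp: \<rho>_def intro: add_mono sum_mono2)
  show ?thesis
  proof (rule that[of "\<lambda>j. G (\<rho> j)"], unfold geometric_exhaustion_def, intro conjI allI impI)
    show "(\<Union>j. G (\<rho> j)) = UNIV"
    proof (intro equalityI subsetI UNIV_I)
      fix n :: "int \<times> int"
      have "n \<in> G (nat \<bar>fst n\<bar> + nat \<bar>snd n\<bar>)" by (cases n) (auto simp: G_def)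
      then show "n \<in> (\<Union>j. G (\<rho> j))" using mono[OF \<rho>(2)] by blast
    qed
    fix j k :: nat assume "j \<le> k"
    then have "(\<Sum>n\<in>G (\<rho> k) - G (\<rho> j). (norm (a n))\<^sup>2) = s (\<rho> k) - s (\<rho> j)"
      by (intro diff \<rho>_mono)
    also have "\<dots> \<le> L - s (\<rho> j)" using L(2) by simp
    also have "\<dots> \<le> 1 / 4 ^ j" using r \<rho>(1) by blast
    finally show "(\<Sum>n\<in>G (\<rho> k) - G (\<rho> j). (norm (a n))\<^sup>2) \<le> 1 / 4 ^ j" .
  next
    show "incseq (\<lambda>j. G (\<rho> j))" by (intro incseq_SucI mono \<rho>_mono) simp
  qed (rule fin)
qed

lemma nn_integral_norm_trig_poly_squared:
  assumes "finite F"
  shows "(\<integral>\<^sup>+z. ennreal ((norm (trig_poly c F z))\<^sup>2) \<partial>torus2)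
    = ennreal ((2 * pi)\<^sup>2 * (\<Sum>n\<in>F. (norm (c n))\<^sup>2))"
  using trig_poly_Lp_space[of c F] integral_norm_trig_poly_squared[OF assms, of c]
  by (subst nn_integral_eq_integral) (auto simp: Lp_space_2_iff)

lemma trig_poly_exhaustion_cauchy:
  assumes F: "geometric_exhaustion a F" and c: "\<And>n. norm (c n) \<le> norm (a n)" and "j \<le> k"
  shows "(\<integral>\<^sup>+z. ennreal ((norm (trig_poly c (F k) z - trig_poly c (F j) z))\<^sup>2) \<partial>torus2)
    \<le> ennreal ((2 * pi)\<^sup>2 / 4 ^ j)"
proof -
  have fin: "finite (F k)" and sub: "F j \<subseteq> F k"
    using F \<open>j \<le> k\<close> by (auto simp: geometric_exhaustion_def incseq_def)
  have "trig_poly c (F k) z - trig_poly c (F j) z = trig_poly c (F k - F j) z" for z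
    unfolding trig_poly_def by (rule sum_diff[OF fin sub, symmetric])
  then have "(\<integral>\<^sup>+z. ennreal ((norm (trig_poly c (F k) z - trig_poly c (F j) z))\<^sup>2) \<partial>torus2)
      = ennreal ((2 * pi)\<^sup>2 * (\<Sum>n\<in>F k - F j. (norm (c n))\<^sup>2))"
    using fin by (simp only: nn_integral_norm_trig_poly_squared finite_Diff)
  also have "\<dots> \<le> ennreal ((2 * pi)\<^sup>2 * (1 / 4 ^ j))"
  proof (intro ennreal_leI mult_left_mono)
    have "(\<Sum>n\<in>F k - F j. (norm (c n))\<^sup>2) \<le> (\<Sum>n\<in>F k - F j. (norm (a n))\<^sup>2)"
      by (intro sum_mono power_mono c) auto
    also have "\<dots> \<le> 1 / 4 ^ j" using F \<open>j \<le> k\<close> by (auto simp: geometric_exhaustion_def)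
    finally show "(\<Sum>n\<in>F k - F j. (norm (c n))\<^sup>2) \<le> 1 / 4 ^ j" .
  qed simp
  finally show ?thesis by simp
qed

lemma Lp_space_2I:
  assumes "f \<in> borel_measurable M" "(\<integral>\<^sup>+z. ennreal ((norm (f z))\<^sup>2) \<partial>M) \<le> ennreal B"
  shows "f \<in> Lp_space 2 M"
  unfolding Lp_space_2_iff using assms
  by (auto intro!: integrableI_bounded simp: le_less_trans[OF _ ennreal_less_top])

lemma Lp_space_2_add:
  assumes "f \<in> Lp_space 2 M" "g \<in> Lp_space 2 M"
  shows "(\<lambda>z. f z + g z) \<in> Lp_space 2 M"
proof -
  have "(\<lambda>z. - g z) \<in> Lp_space 2 M"
    using assms(2) by (auto simp: Lp_space_2_iff)
  from Lp_space_2_diff[OF assms(1) this] show ?thesis by simp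
qed

text \<open>By Fatou the almost everywhere limit is also approached in L^2, at the same rate;
  Bessel's inequality for a single frequency then identifies its coefficients.\<close>

theorem Riesz_Fischer:
  assumes F: "geometric_exhaustion a F" and c: "\<And>n. norm (c n) \<le> norm (a n)"
  defines "f \<equiv> \<lambda>z. lim (\<lambda>j. trig_poly c (F j) z)"
  shows "f \<in> Lp_space 2 torus2" "tcoeff f n = c n"
    "AE z in torus2. (\<lambda>j. trig_poly c (F j) z) \<longlonglongrightarrow> f z"
proof -
  have fin: "finite (F j)" for j using F by (simp add: geometric_exhaustion_def)
  have meas: "trig_poly c (F j) \<in> borel_measurable torus2" for j by measurable
  note cauchy = trig_poly_exhaustion_cauchy[OF F c]
  show "AE z in torus2. (\<lambda>j. trig_poly c (F j) z) \<longlonglongrightarrow> f z"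
    unfolding f_def by (rule AE_convergent_L2[OF meas _ cauchy]) auto
  have bound: "(\<integral>\<^sup>+z. ennreal ((norm (f z - trig_poly c (F j) z))\<^sup>2) \<partial>torus2) \<le> ennreal ((2 * pi)\<^sup>2 / 4 ^ j)" for j
    unfolding f_def by (rule L2_lim_bound[OF meas _ cauchy]) auto
  have fm [measurable]: "f \<in> borel_measurable torus2"
    unfolding f_def by measurable
  have diff: "(\<lambda>z. f z - trig_poly c (F j) z) \<in> Lp_space 2 torus2" for j
    by (rule Lp_space_2I[OF _ bound]) measurable
  show f: "f \<in> Lp_space 2 torus2"
    using Lp_space_2_add[OF diff trig_poly_Lp_space, of 0 c "F 0"] by simp
  have "n \<in> (\<Union>j. F j)"
    using F by (simp add: geometric_exhaustion_def)
  then obtain j0 where "n \<in> F j0" by blast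
  then have n: "n \<in> F j" if "j \<ge> j0" for j
    using F that by (auto simp: geometric_exhaustion_def incseq_def)
  \<comment> \<open>Once \<open>F j\<close> contains \<open>n\<close>, the partial sum has
    coefficient exactly \<open>c n\<close>, so the coefficient error is controlled by the L^2
    error.\<close>
  have *: "(norm (tcoeff f n - c n))\<^sup>2 \<le> 1 / 4 ^ j" if "j \<ge> j0" for j
  proof -
    let ?h = "\<lambda>z. f z - trig_poly c (F j) z"
    have "tcoeff ?h n = tcoeff f n - c n"
      using n[OF that] fin by (simp add: tcoeff_diff Lp_space_2_integrable[OF f] tcoeff_trig_poly)
    then have "(2 * pi)\<^sup>2 * (norm (tcoeff f n - c n))\<^sup>2 \<le> (LINT z|torus2. (norm (?h z))\<^sup>2)"
      using Bessel_inequality[OF diff[of j], of "{n}"] by simp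
    also have "ennreal \<dots> \<le> ennreal ((2 * pi)\<^sup>2 / 4 ^ j)"
      using bound[of j] diff[of j] by (subst nn_integral_eq_integral[symmetric]) (auto simp: Lp_space_2_iff)
    then have "(LINT z|torus2. (norm (?h z))\<^sup>2) \<le> (2 * pi)\<^sup>2 * (1 / 4 ^ j)"
      by (subst (asm) ennreal_le_iff) auto
    finally show ?thesis by (subst (asm) mult_le_cancel_left_pos) auto
  qed
  have "(\<lambda>j. 1 / 4 ^ j :: real) \<longlonglongrightarrow> 0" by real_asymp
  then have "(norm (tcoeff f n - c n))\<^sup>2 \<le> 0"
    by (rule tendsto_lowerbound) (use * in \<open>auto simp: eventually_at_top_linorder\<close>)
  then show "tcoeff f n = c n" by simp
qed

section \<open>Almost orthogonality of exponential sums\<close>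

text \<open>The parabolic weight is a simple choice that is positive inside the interval and
  vanishes at both ends; against exponentials it has an explicit antiderivative.\<close>

definition bump_transform :: "real \<Rightarrow> real \<Rightarrow> complex" where
  "bump_transform L \<delta> = (LINT t|lborel. indicator {-L..L} t *\<^sub>R (complex_of_real (L\<^sup>2 - t\<^sup>2) * cis (\<delta> * t)))"

lemma integrable_bump:
  "integrable lborel (\<lambda>t. indicator {-L..L} t *\<^sub>R (complex_of_real (L\<^sup>2 - t\<^sup>2) * cis (\<delta> * t)))"
proof -
  have "set_integrable lborel {-L..L} (\<lambda>t. complex_of_real (L\<^sup>2 - t\<^sup>2) * cis (\<delta> * t))"
    by (intro borel_integrable_atLeastAtMost' continuous_intros)
  then show ?thesis by (simp add: set_integrable_def)
qed

lemma norm_bump_transform_trivial: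
  assumes "L > 0"
  shows "norm (bump_transform L \<delta>) \<le> 2 * L ^ 3"
proof -
  have "norm (bump_transform L \<delta>)
      \<le> (LINT t|lborel. norm (indicator {-L..L} t *\<^sub>R (complex_of_real (L\<^sup>2 - t\<^sup>2) * cis (\<delta> * t))))"
    unfolding bump_transform_def by (rule integral_norm_bound)
  also have "\<dots> \<le> (LINT t|lborel. indicator {-L..L} t *\<^sub>R L\<^sup>2)"
  proof (rule integral_mono)
    show "integrable lborel (\<lambda>t. norm (indicator {-L..L} t *\<^sub>R (complex_of_real (L\<^sup>2 - t\<^sup>2) * cis (\<delta> * t))))"
      by (intro integrable_norm integrable_bump)
    show "integrable lborel (\<lambda>t. indicator {-L..L} t *\<^sub>R L\<^sup>2)"
      using borel_integrable_atLeastAtMost'[of "-L" L "\<lambda>_. L\<^sup>2"] by (simp add: set_integrable_def)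
    fix t
    have "\<bar>L\<^sup>2 - t\<^sup>2\<bar> \<le> L\<^sup>2" if "-L \<le> t" "t \<le> L"
    proof -
      have "t\<^sup>2 \<le> L\<^sup>2" using that by (intro abs_le_square_iff[THEN iffD1]) auto
      then show ?thesis by simp
    qed
    then show "norm (indicator {-L..L} t *\<^sub>R (complex_of_real (L\<^sup>2 - t\<^sup>2) * cis (\<delta> * t))) \<le> indicator {-L..L} t *\<^sub>R L\<^sup>2"
      by (cases "t \<in> {-L..L}") (simp_all add: norm_mult del: of_real_diff of_real_power)
  qed
  also have "\<dots> = 2 * L ^ 3"
    using assms by (simp add: power2_eq_square power3_eq_cube)
  finally show ?thesis .
qed

lemma norm_bump_transform_decay:
  assumes L: "L > 0" and \<delta>: "\<bar>\<delta>\<bar> \<ge> 1"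
  shows "norm (bump_transform L \<delta>) \<le> (4 * L + 4) / \<delta>\<^sup>2"
proof -
  define c where "c = \<i> * complex_of_real \<delta>"
  have c: "c \<noteq> 0" "norm c = \<bar>\<delta>\<bar>" using \<delta> by (auto simp: c_def norm_mult)
  define a where "a = 1 / c"
  have a: "norm a = 1 / \<bar>\<delta>\<bar>" "c * a = 1" using c by (simp_all add: a_def norm_divide)
  \<comment> \<open>Antiderivative from integrating by parts until the weight w is exhausted: w a -
    w' a^2 + w'' a^3 with a = 1 / (i delta). At t = L and t = -L the leading term vanishes, leaving
    order a^2.\<close>
  define F where "F t = cis (\<delta> * t) * (complex_of_real (L\<^sup>2 - t\<^sup>2) * a + 2 * complex_of_real t * a\<^sup>2 - 2 * a ^ 3)" for t
  have "bump_transform L \<delta> = F L - F (- L)"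
    unfolding bump_transform_def
  proof (rule integral_FTC_Icc)
    fix t
    have 1: "((\<lambda>t. cis (\<delta> * t)) has_vector_derivative c * cis (\<delta> * t)) (at t within {-L..L})"
      by (auto intro!: derivative_eq_intros simp: has_vector_derivative_def c_def fun_eq_iff scaleR_conv_of_real algebra_simps)
    have 2: "((\<lambda>t. complex_of_real (L\<^sup>2 - t\<^sup>2) * a + 2 * complex_of_real t * a\<^sup>2 - 2 * a ^ 3)
        has_vector_derivative (- 2 * complex_of_real t * a + 2 * a\<^sup>2)) (at t within {-L..L})"
      by (auto intro!: derivative_eq_intros simp: has_vector_derivative_def fun_eq_iff scaleR_conv_of_real algebra_simps)
    have "(F has_vector_derivative cis (\<delta> * t) * (- 2 * complex_of_real t * a + 2 * a\<^sup>2)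
        + (c * cis (\<delta> * t)) * (complex_of_real (L\<^sup>2 - t\<^sup>2) * a + 2 * complex_of_real t * a\<^sup>2 - 2 * a ^ 3)) (at t within {-L..L})"
      unfolding F_def by (rule has_vector_derivative_mult[OF 1 2])
    also have "cis (\<delta> * t) * (- 2 * complex_of_real t * a + 2 * a\<^sup>2)
        + (c * cis (\<delta> * t)) * (complex_of_real (L\<^sup>2 - t\<^sup>2) * a + 2 * complex_of_real t * a\<^sup>2 - 2 * a ^ 3)
        = complex_of_real (L\<^sup>2 - t\<^sup>2) * cis (\<delta> * t)"
      using a(2) by algebra
    finally show "(F has_vector_derivative complex_of_real (L\<^sup>2 - t\<^sup>2) * cis (\<delta> * t)) (at t within {-L..L})" .
  qed (use L in \<open>auto intro!: continuous_intros\<close>)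
  moreover have "norm (F t) \<le> (2 * L + 2) / \<delta>\<^sup>2" if "\<bar>t\<bar> = L" for t
  proof -
    have "L\<^sup>2 - t\<^sup>2 = 0" using that by (metis power2_abs diff_self)
    then have "norm (F t) = norm (2 * complex_of_real t * a\<^sup>2 - 2 * a ^ 3)"
      unfolding F_def by (simp only: norm_mult norm_cis) simp
    also have "\<dots> \<le> norm (2 * complex_of_real t * a\<^sup>2) + norm (2 * a ^ 3)"
      by (rule norm_triangle_ineq4)
    also have "\<dots> = 2 * L / \<delta>\<^sup>2 + 2 / \<bar>\<delta>\<bar> ^ 3"
      using that a by (simp add: norm_mult norm_power power_divide)
    also have "2 / \<bar>\<delta>\<bar> ^ 3 \<le> 2 / \<bar>\<delta>\<bar> ^ 2"
      using \<delta> by (intro divide_left_mono power_increasing) auto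
    finally show ?thesis by (simp add: add_divide_distrib)
  qed
  from this[of L] this[of "-L"] have "norm (F L - F (- L)) \<le> (2 * L + 2) / \<delta>\<^sup>2 + (2 * L + 2) / \<delta>\<^sup>2"
    using L by (intro order.trans[OF norm_triangle_ineq4] add_mono) auto
  ultimately show ?thesis by (simp add: add_divide_distrib[symmetric])
qed

text \<open>Integer parts make the kernel bound constant on unit windows of frequencies. They change
  the gap by less than 1, whence 1 + d^2 \<le> 3 (1 + delta^2); the numerator is three times the sum
  of the bounds for small and for large gaps.\<close>

lemma norm_bump_transform_floor:
  assumes L: "L > 0"
  shows "norm (bump_transform L (x - y)) \<le> (12 * L ^ 3 + 24 * L + 24) / (1 + (of_int (\<lfloor>x\<rfloor> - \<lfloor>y\<rfloor>))\<^sup>2)"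
proof -
  let ?\<delta> = "x - y"
  define d where "d = real_of_int (\<lfloor>x\<rfloor> - \<lfloor>y\<rfloor>)"
  have 1: "norm (bump_transform L ?\<delta>) * (1 + ?\<delta>\<^sup>2) \<le> 4 * L ^ 3 + 8 * L + 8"
  proof (cases "\<bar>?\<delta>\<bar> \<ge> 1")
    case True
    then have \<delta>: "?\<delta>\<^sup>2 \<ge> 1" by (metis one_power2 power2_abs power_mono zero_le_one)
    have "norm (bump_transform L ?\<delta>) * (1 + ?\<delta>\<^sup>2) \<le> (4 * L + 4) / ?\<delta>\<^sup>2 * (2 * ?\<delta>\<^sup>2)"
      using \<delta> L by (intro mult_mono norm_bump_transform_decay True) auto
    also have "\<dots> = 8 * L + 8" using True by (simp add: divide_simps)
    finally show ?thesis using L by (smt (verit) zero_less_power)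
  next
    case False
    then have \<delta>: "?\<delta>\<^sup>2 \<le> 1" by (simp add: abs_square_le_1)
    have "norm (bump_transform L ?\<delta>) * (1 + ?\<delta>\<^sup>2) \<le> (2 * L ^ 3) * 2"
      using \<delta> L by (intro mult_mono norm_bump_transform_trivial) auto
    then show ?thesis using L by simp
  qed
  have "\<bar>d\<bar> \<le> \<bar>?\<delta>\<bar> + 1" unfolding d_def by linarith
  then have "d\<^sup>2 \<le> (\<bar>?\<delta>\<bar> + 1)\<^sup>2" by (metis abs_ge_zero power2_abs power_mono)
  also have "\<dots> \<le> 2 * ?\<delta>\<^sup>2 + 2"
    using zero_le_power2[of "\<bar>?\<delta>\<bar> - 1"] by (simp add: power2_sum power2_diff)
  finally have "1 + d\<^sup>2 \<le> 3 + 2 * ?\<delta>\<^sup>2" by simp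
  also have "\<dots> \<le> 3 * (1 + ?\<delta>\<^sup>2)" by simp
  finally have "1 + d\<^sup>2 \<le> 3 * (1 + ?\<delta>\<^sup>2)" .
  then have "norm (bump_transform L ?\<delta>) * (1 + d\<^sup>2) \<le> norm (bump_transform L ?\<delta>) * (3 * (1 + ?\<delta>\<^sup>2))"
    by (rule mult_left_mono) simp
  also have "\<dots> = 3 * (norm (bump_transform L ?\<delta>) * (1 + ?\<delta>\<^sup>2))" by simp
  also have "\<dots> \<le> 3 * (4 * L ^ 3 + 8 * L + 8)" using 1 by (rule mult_left_mono) simp
  also have "\<dots> = 12 * L ^ 3 + 24 * L + 24" by simp
  finally show ?thesis
    unfolding d_def[symmetric] by (subst pos_le_divide_eq) (auto intro: add_pos_nonneg)
qed

text \<open>After translation by \<open>l0\<close> the sum is over distinct integers. On the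
  nonnegative and on the negative ones the absolute value is injective, so each half is at most the
  series over the naturals.\<close>

lemma sum_int_inverse_square_bound:
  obtains S :: real where "S > 0" "\<And>D (l0 :: int). finite D \<Longrightarrow> (\<Sum>l\<in>D. 1 / (1 + (of_int (l0 - l))\<^sup>2)) \<le> S"
proof -
  define h where "h n = 1 / (1 + (real n)\<^sup>2)" for n
  have h: "summable h"
  proof (rule summable_comparison_test')
    show "summable (\<lambda>n. inverse (real n ^ 2))" by (rule inverse_power_summable) simp
    show "norm (h n) \<le> inverse (real n ^ 2)" if "n \<ge> 1" for n
      using that by (simp add: h_def inverse_eq_divide frac_le)
  qed
  have h0: "h n \<ge> 0" for n by (simp add: h_def)
  have half: "(\<Sum>d\<in>D. h (nat \<bar>d\<bar>)) \<le> suminf h" if "finite D" "inj_on (\<lambda>d. nat \<bar>d\<bar>) D" for D :: "int set"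
  proof -
    have "(\<Sum>d\<in>D. h (nat \<bar>d\<bar>)) = sum h ((\<lambda>d. nat \<bar>d\<bar>) ` D)"
      using that(2) by (simp add: sum.reindex)
    also have "\<dots> \<le> suminf h" by (rule sum_le_suminf) (use h h0 that in auto)
    finally show ?thesis .
  qed
  have all: "(\<Sum>d\<in>D. h (nat \<bar>d\<bar>)) \<le> 2 * suminf h" if "finite D" for D :: "int set"
  proof -
    have "D = {d\<in>D. d \<ge> 0} \<union> {d\<in>D. d < 0}" by auto
    then have "(\<Sum>d\<in>D. h (nat \<bar>d\<bar>)) = (\<Sum>d\<in>{d\<in>D. d \<ge> 0}. h (nat \<bar>d\<bar>)) + (\<Sum>d\<in>{d\<in>D. d < 0}. h (nat \<bar>d\<bar>))"
      using that by (subst sum.union_disjoint[symmetric]) auto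
    moreover have "(\<Sum>d\<in>{d\<in>D. d \<ge> 0}. h (nat \<bar>d\<bar>)) \<le> suminf h" "(\<Sum>d\<in>{d\<in>D. d < 0}. h (nat \<bar>d\<bar>)) \<le> suminf h"
      using that by (intro half; auto simp: inj_on_def)+
    ultimately show ?thesis by simp
  qed
  show ?thesis
  proof
    show "2 * suminf h > 0"
      using suminf_pos[OF h] by (simp add: h_def add_pos_nonneg)
    fix D :: "int set" and l0 :: int assume "finite D"
    have "(\<Sum>l\<in>D. 1 / (1 + (of_int (l0 - l))\<^sup>2)) = (\<Sum>l\<in>D. h (nat \<bar>l0 - l\<bar>))"
      by (intro sum.cong refl) (simp add: h_def of_nat_nat)
    also have "\<dots> = (\<Sum>d\<in>(\<lambda>l. l0 - l) ` D. h (nat \<bar>d\<bar>))"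
      by (subst sum.reindex) (auto simp: inj_on_def)
    also have "\<dots> \<le> 2 * suminf h" using \<open>finite D\<close> by (intro all) auto
    finally show "(\<Sum>l\<in>D. 1 / (1 + (of_int (l0 - l))\<^sup>2)) \<le> 2 * suminf h" .
  qed
qed

text \<open>Schur's test for a symmetric kernel: by 2 b(x) b(y) \<le> b(x)^2 + b(y)^2 and symmetry,
  only row sums remain.\<close>

lemma Schur_sum:
  fixes b :: "'a \<Rightarrow> real"
  assumes X: "finite X" and sym: "\<And>x y. \<kappa> x y = \<kappa> y x" and nn: "\<And>x y. \<kappa> x y \<ge> 0"
    and S: "\<And>x. x \<in> X \<Longrightarrow> (\<Sum>y\<in>X. \<kappa> x y) \<le> S"
  shows "(\<Sum>x\<in>X. \<Sum>y\<in>X. b x * b y * \<kappa> x y) \<le> S * (\<Sum>x\<in>X. (b x)\<^sup>2)"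
proof -
  have am: "b x * b y * \<kappa> x y \<le> (b x)\<^sup>2 * \<kappa> x y / 2 + (b y)\<^sup>2 * \<kappa> x y / 2" for x y
  proof -
    have "b x * b y \<le> ((b x)\<^sup>2 + (b y)\<^sup>2) / 2" using sum_squares_bound[of "b x" "b y"] by simp
    from mult_right_mono[OF this nn[of x y]] show ?thesis by (simp add: field_simps)
  qed
  have "(\<Sum>x\<in>X. \<Sum>y\<in>X. b x * b y * \<kappa> x y)
      \<le> (\<Sum>x\<in>X. \<Sum>y\<in>X. (b x)\<^sup>2 * \<kappa> x y / 2) + (\<Sum>x\<in>X. \<Sum>y\<in>X. (b y)\<^sup>2 * \<kappa> x y / 2)"
    unfolding sum.distrib[symmetric] by (intro sum_mono am)
  also have "(\<Sum>x\<in>X. \<Sum>y\<in>X. (b y)\<^sup>2 * \<kappa> x y / 2) = (\<Sum>x\<in>X. \<Sum>y\<in>X. (b x)\<^sup>2 * \<kappa> x y / 2)"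
    by (subst sum.swap) (simp add: sym)
  also have "(\<Sum>x\<in>X. \<Sum>y\<in>X. (b x)\<^sup>2 * \<kappa> x y / 2) + (\<Sum>x\<in>X. \<Sum>y\<in>X. (b x)\<^sup>2 * \<kappa> x y / 2)
      = (\<Sum>x\<in>X. (b x)\<^sup>2 * (\<Sum>y\<in>X. \<kappa> x y))"
    unfolding sum.distrib[symmetric] sum_distrib_left by (simp add: mult.commute)
  also have "\<dots> \<le> (\<Sum>x\<in>X. (b x)\<^sup>2 * S)"
    by (intro sum_mono mult_left_mono S) auto
  finally show ?thesis by (simp add: sum_distrib_left mult.commute)
qed

text \<open>Expanding the square turns the weighted integral into a quadratic form with kernel
  \<open>bump_transform\<close>, to which Schur's test applies. \<open>Q\<close> depends on
  \<open>L\<close> alone; the frequencies enter only through the bound \<open>B\<close> on the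
  occupation of unit windows.\<close>

lemma exponential_sum_L2_bound:
  assumes L: "L > 0"
  obtains Q where "Q > 0"
    "\<And>(X :: 'a set) A \<mu> B. finite X \<Longrightarrow> (\<And>l::int. real (card {x\<in>X. \<lfloor>\<mu> x\<rfloor> = l}) \<le> B) \<Longrightarrow>
      (LINT t|lborel. indicator {-L..L} t * ((L\<^sup>2 - t\<^sup>2) * (norm (\<Sum>x\<in>X. A x * cis (\<mu> x * t)))\<^sup>2))
        \<le> Q * B * (\<Sum>x\<in>X. (norm (A x))\<^sup>2)"
proof -
  obtain S :: real where S: "S > 0" "\<And>D (l0 :: int). finite D \<Longrightarrow> (\<Sum>l\<in>D. 1 / (1 + (of_int (l0 - l))\<^sup>2)) \<le> S"
    using sum_int_inverse_square_bound by blast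
  define M where "M = 12 * L ^ 3 + 24 * L + 24"
  have M: "M > 0" using L by (simp add: M_def add_pos_pos)
  show ?thesis
  proof (rule that[of "M * S"])
    show "M * S > 0" using M S by simp
    fix X :: "'a set" and A :: "'a \<Rightarrow> complex" and \<mu> :: "'a \<Rightarrow> real" and B :: real
    assume X: "finite X" and B: "\<And>l::int. real (card {x\<in>X. \<lfloor>\<mu> x\<rfloor> = l}) \<le> B"
    define \<kappa> where "\<kappa> x y = 1 / (1 + (real_of_int (\<lfloor>\<mu> x\<rfloor> - \<lfloor>\<mu> y\<rfloor>))\<^sup>2)" for x y
    have \<kappa>0: "\<kappa> x y \<ge> 0" for x y by (simp add: \<kappa>_def)
    have \<kappa>S: "(\<Sum>y\<in>X. \<kappa> x y) \<le> B * S" for x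
    proof -
      let ?f = "\<lambda>y. \<lfloor>\<mu> y\<rfloor>" and ?k = "\<lambda>l. 1 / (1 + (real_of_int (\<lfloor>\<mu> x\<rfloor> - l))\<^sup>2)"
      have "B \<ge> 0" using B[of 0] by linarith
      \<comment> \<open>Grouping by unit window: each window contributes at most \<open>B\<close>
        copies of the inverse square kernel at the distance of the integer parts.\<close>
      have "(\<Sum>y\<in>X. \<kappa> x y) = (\<Sum>l\<in>?f ` X. \<Sum>y\<in>{y\<in>X. ?f y = l}. \<kappa> x y)"
        by (rule sum.image_gen[OF X])
      also have "\<dots> = (\<Sum>l\<in>?f ` X. real (card {y\<in>X. ?f y = l}) * ?k l)"
        by (intro sum.cong refl) (simp add: \<kappa>_def)
      also have "\<dots> \<le> (\<Sum>l\<in>?f ` X. B * ?k l)"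
        by (intro sum_mono mult_right_mono B) auto
      also have "\<dots> = B * (\<Sum>l\<in>?f ` X. ?k l)" by (simp add: sum_distrib_left)
      also have "\<dots> \<le> B * S" using X \<open>B \<ge> 0\<close> by (intro mult_left_mono S) auto
      finally show ?thesis .
    qed
    let ?g = "\<lambda>t. \<Sum>x\<in>X. A x * cis (\<mu> x * t)"
    let ?T = "\<lambda>\<delta> t. indicator {-L..L} t *\<^sub>R (complex_of_real (L\<^sup>2 - t\<^sup>2) * cis (\<delta> * t))"
    have "complex_of_real (indicator {-L..L} t * ((L\<^sup>2 - t\<^sup>2) * (norm (?g t))\<^sup>2))
        = (\<Sum>x\<in>X. \<Sum>y\<in>X. A x * cnj (A y) * ?T (\<mu> x - \<mu> y) t)" for t
    proof -
      have "complex_of_real (indicator {-L..L} t * ((L\<^sup>2 - t\<^sup>2) * (norm (?g t))\<^sup>2))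
          = indicator {-L..L} t * (complex_of_real (L\<^sup>2 - t\<^sup>2) * (?g t * cnj (?g t)))"
        by (simp only: of_real_mult of_real_indicator complex_norm_square)
      also have "?g t * cnj (?g t) = (\<Sum>x\<in>X. \<Sum>y\<in>X. (A x * cis (\<mu> x * t)) * cnj (A y * cis (\<mu> y * t)))"
        by (simp add: sum_product)
      also have "\<dots> = (\<Sum>x\<in>X. \<Sum>y\<in>X. A x * cnj (A y) * cis ((\<mu> x - \<mu> y) * t))"
        by (intro sum.cong refl) (simp add: cis_cnj algebra_simps cis_mult cis_divide)
      also have "indicator {-L..L} t * (complex_of_real (L\<^sup>2 - t\<^sup>2)
          * (\<Sum>x\<in>X. \<Sum>y\<in>X. A x * cnj (A y) * cis ((\<mu> x - \<mu> y) * t)))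
          = (\<Sum>x\<in>X. \<Sum>y\<in>X. A x * cnj (A y) * ?T (\<mu> x - \<mu> y) t)"
        unfolding sum_distrib_left
        by (intro sum.cong refl) (cases "t \<in> {-L..L}"; simp del: of_real_diff of_real_power)
      finally show ?thesis .
    qed
    then have "complex_of_real (LINT t|lborel. indicator {-L..L} t * ((L\<^sup>2 - t\<^sup>2) * (norm (?g t))\<^sup>2))
        = (LINT t|lborel. (\<Sum>x\<in>X. \<Sum>y\<in>X. A x * cnj (A y) * ?T (\<mu> x - \<mu> y) t))"
      by (simp only: integral_complex_of_real[symmetric])
    also have "\<dots> = (\<Sum>x\<in>X. LINT t|lborel. (\<Sum>y\<in>X. A x * cnj (A y) * ?T (\<mu> x - \<mu> y) t))"
      by (intro Bochner_Integration.integral_sum Bochner_Integration.integrable_sum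
          integrable_mult_right integrable_bump)
    also have "\<dots> = (\<Sum>x\<in>X. \<Sum>y\<in>X. LINT t|lborel. A x * cnj (A y) * ?T (\<mu> x - \<mu> y) t)"
      by (intro sum.cong refl Bochner_Integration.integral_sum integrable_mult_right integrable_bump)
    also have "\<dots> = (\<Sum>x\<in>X. \<Sum>y\<in>X. A x * cnj (A y) * bump_transform L (\<mu> x - \<mu> y))"
      by (simp only: integral_mult_right_zero bump_transform_def)
    finally have "norm (complex_of_real (LINT t|lborel. indicator {-L..L} t * ((L\<^sup>2 - t\<^sup>2) * (norm (?g t))\<^sup>2)))
        = norm (\<Sum>x\<in>X. \<Sum>y\<in>X. A x * cnj (A y) * bump_transform L (\<mu> x - \<mu> y))"
      by (rule arg_cong)
    also have "\<dots> \<le> (\<Sum>x\<in>X. \<Sum>y\<in>X. norm (A x) * norm (A y) * (M * \<kappa> x y))"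
    proof (intro sum_norm_le)
      fix x y
      have "norm (bump_transform L (\<mu> x - \<mu> y)) \<le> M * \<kappa> x y"
        using norm_bump_transform_floor[OF L, of "\<mu> x" "\<mu> y"] by (simp add: M_def \<kappa>_def)
      then show "norm (A x * cnj (A y) * bump_transform L (\<mu> x - \<mu> y)) \<le> norm (A x) * norm (A y) * (M * \<kappa> x y)"
        by (simp add: norm_mult mult_left_mono)
    qed
    also have "\<dots> = M * (\<Sum>x\<in>X. \<Sum>y\<in>X. norm (A x) * norm (A y) * \<kappa> x y)"
      unfolding sum_distrib_left by (intro sum.cong refl) simp
    also have "\<dots> \<le> M * (B * S * (\<Sum>x\<in>X. (norm (A x))\<^sup>2))"
    proof (intro mult_left_mono Schur_sum X \<kappa>S \<kappa>0)
      show "\<kappa> x y = \<kappa> y x" for x y by (simp add: \<kappa>_def power2_commute)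
    qed (use M in auto)
    finally show "(LINT t|lborel. indicator {-L..L} t * ((L\<^sup>2 - t\<^sup>2) * (norm (?g t))\<^sup>2))
        \<le> M * S * B * (\<Sum>x\<in>X. (norm (A x))\<^sup>2)"
      unfolding norm_of_real mult.assoc mult.left_commute[of B S] by (rule order.trans[OF abs_ge_self])
  qed
qed

section \<open>Counting near-resonances\<close>

lemma card_int_le_diameter:
  fixes A :: "int set" and D :: real
  assumes "finite A" and D: "\<And>x y. x \<in> A \<Longrightarrow> y \<in> A \<Longrightarrow> real_of_int \<bar>x - y\<bar> \<le> D" and "D \<ge> 0"
  shows "real (card A) \<le> D + 1"
proof (cases "A = {}")
  case False
  have "card A \<le> card {Min A..Max A}"
    by (rule card_mono) (use assms False in auto)
  moreover have "Min A \<le> Max A" using assms(1) False by simp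
  ultimately have "real (card A) \<le> real_of_int (Max A - Min A) + 1" by simp
  also have "real_of_int (Max A - Min A) \<le> D"
    using D[of "Max A" "Min A"] assms(1) False \<open>Min A \<le> Max A\<close> by simp
  finally show ?thesis by simp
qed (use assms in auto)

text \<open>Superadditivity of the fourth power: in the expansion of ((u - v) + v)^4 all cross terms
  are nonnegative. It turns a bound on u^4 - v^4 into a bound on u - v that does not degenerate near
  0.\<close>

lemma power4_diff_le:
  fixes u v :: real
  assumes "0 \<le> v" "v \<le> u"
  shows "(u - v) ^ 4 \<le> u ^ 4 - v ^ 4"
proof -
  have "u ^ 4 = (u - v) ^ 4 + v ^ 4 + 2 * (u - v) * v * (2 * (u - v)\<^sup>2 + 3 * (u - v) * v + 2 * v\<^sup>2)"
    by algebra
  moreover have "0 \<le> 2 * (u - v) * v * (2 * (u - v)\<^sup>2 + 3 * (u - v) * v + 2 * v\<^sup>2)"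
    using assms by simp
  ultimately show ?thesis by linarith
qed

text \<open>The symbol of the evolution, with \<open>\<beta>\<close> in place of
  \<open>- \<alpha>\<close>, so that \<open>\<beta>\<close> is positive in the theorem.\<close>

definition disp :: "real \<Rightarrow> int \<times> int \<Rightarrow> real" where
  "disp \<beta> n = \<beta> * of_int (fst n) ^ 4 + (of_int (snd n))\<^sup>2"

definition size1 :: "int \<times> int \<Rightarrow> real" where
  "size1 n = 1 + \<bar>of_int (fst n)\<bar> + \<bar>of_int (snd n)\<bar>"

text \<open>In the coordinates \<open>p = 2 m\<^sub>1 - k\<^sub>1\<close>, \<open>q = 2 m\<^sub>2 - k\<^sub>2\<close> the resonance function becomes even
  in both variables.\<close>

lemma disp_add_disp_reflect:
  "disp \<beta> m + disp \<beta> (k - m) =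
    \<beta> / 8 * (of_int (fst k) ^ 4 + 6 * (of_int (fst k))\<^sup>2 * (of_int (2 * fst m - fst k))\<^sup>2 + of_int (2 * fst m - fst k) ^ 4)
    + ((of_int (snd k))\<^sup>2 + (of_int (2 * snd m - snd k))\<^sup>2) / 2"
  by (simp add: disp_def field_simps power2_eq_square power4_eq_xxxx)

text \<open>The labelling gives \<open>m\<close> the larger |p|. Both p-dependent terms of the
  resonance function then grow from \<open>m'\<close> to \<open>m\<close>, and within the window
  this growth can only be compensated by q'^2, which is at most 4 N^2; superadditivity bounds (u -
  v)^4 by the growth of the quartic term. The constant 24 is 8, from the factor
  \<open>\<beta> / 8\<close>, times 3, from 1 + q'^2 / 2 \<le> 3 N^2.\<close>

lemma resonance_first_coordinate_aux:
  assumes \<beta>: "\<beta> > 0" and N: "N \<ge> 1"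
    and size: "size1 m' \<le> N" "size1 (k - m') \<le> N"
    and near: "\<bar>(disp \<beta> m + disp \<beta> (k - m)) - (disp \<beta> m' + disp \<beta> (k - m'))\<bar> < 1"
    and sign: "2 * fst m - fst k \<ge> 0 \<longleftrightarrow> 2 * fst m' - fst k \<ge> 0"
    and le: "\<bar>2 * fst m' - fst k\<bar> \<le> \<bar>2 * fst m - fst k\<bar>"
  shows "real_of_int \<bar>fst m - fst m'\<bar> \<le> sqrt (sqrt (24 / \<beta>)) * sqrt N"
proof -
  define u v where "u = real_of_int \<bar>2 * fst m - fst k\<bar>" and "v = real_of_int \<bar>2 * fst m' - fst k\<bar>"
  define q q' where "q = real_of_int (2 * snd m - snd k)" and "q' = real_of_int (2 * snd m' - snd k)"
  have vu: "0 \<le> v" "v \<le> u" using le unfolding u_def v_def by linarith+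
  \<comment> \<open>Equal signs make the difference of the absolute values an absolute difference;
    the factor 2 comes from p = 2 m1 - k1.\<close>
  have uv: "u - v = 2 * real_of_int \<bar>fst m - fst m'\<bar>"
  proof -
    have "\<bar>2 * fst m - fst k\<bar> - \<bar>2 * fst m' - fst k\<bar> = 2 * \<bar>fst m - fst m'\<bar>"
      using le sign by (smt (verit))
    then show ?thesis unfolding u_def v_def by (simp flip: of_int_diff)
  qed
  \<comment> \<open>Here q' = m2' - (k2 - m2'), a difference of two second coordinates of size at
    most N.\<close>
  have "\<bar>q'\<bar> \<le> 2 * N" using size unfolding q'_def size1_def by simp
  then have "q'\<^sup>2 \<le> (2 * N)\<^sup>2" by (metis abs_ge_zero power2_abs power_mono)
  then have q': "q'\<^sup>2 \<le> 4 * N\<^sup>2" by (simp add: power_mult_distrib)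
  have N2: "1 \<le> N\<^sup>2" using N by simp
  let ?c = "6 * (real_of_int (fst k))\<^sup>2"
  define W where "W = (u ^ 4 - v ^ 4) + ?c * (u\<^sup>2 - v\<^sup>2)"
  have eq: "\<beta> / 8 * (a + c * x + y) + (b + z) / 2 - (\<beta> / 8 * (a + c * x' + y') + (b + z') / 2)
      = \<beta> / 8 * ((y - y') + c * (x - x')) + (z - z') / 2" for a b c x y z x' y' z'
    by (simp add: field_simps)
  have pow: "(real_of_int (2 * fst m - fst k))\<^sup>2 = u\<^sup>2" "real_of_int (2 * fst m - fst k) ^ 4 = u ^ 4"
    "(real_of_int (2 * fst m' - fst k))\<^sup>2 = v\<^sup>2" "real_of_int (2 * fst m' - fst k) ^ 4 = v ^ 4"
    unfolding u_def v_def of_int_abs by (simp_all only: power_even_abs_numeral even_numeral)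
  have "(disp \<beta> m + disp \<beta> (k - m)) - (disp \<beta> m' + disp \<beta> (k - m')) = \<beta> / 8 * W + (q\<^sup>2 - q'\<^sup>2) / 2"
    unfolding disp_add_disp_reflect pow q_def[symmetric] q'_def[symmetric] W_def by (rule eq)
  then have "\<beta> / 8 * W + (q\<^sup>2 - q'\<^sup>2) / 2 < 1" using near by (simp only: abs_less_iff)
  then have "\<beta> / 8 * W \<le> 1 + q'\<^sup>2 / 2 - q\<^sup>2 / 2" by (simp add: diff_divide_distrib)
  also have "\<dots> \<le> N\<^sup>2 + 2 * N\<^sup>2"
    using q' N2 zero_le_power2[of q] by linarith
  finally have 1: "\<beta> / 8 * W \<le> 3 * N\<^sup>2" by simp
  have "0 \<le> ?c * (u\<^sup>2 - v\<^sup>2)" using vu by (intro mult_nonneg_nonneg) (auto intro: power_mono)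
  then have "(u - v) ^ 4 \<le> W" using power4_diff_le[OF vu] unfolding W_def by linarith
  then have "\<beta> / 8 * (u - v) ^ 4 \<le> \<beta> / 8 * W"
    using \<beta> by (intro mult_left_mono) auto
  with 1 have "\<beta> / 8 * (u - v) ^ 4 \<le> 3 * N\<^sup>2" by linarith
  then have "(u - v) ^ 4 \<le> 24 / \<beta> * N\<^sup>2"
    using \<beta> by (simp add: pos_le_divide_eq mult.commute)
  also have "\<dots> = (sqrt (sqrt (24 / \<beta>)) * sqrt N) ^ 4"
  proof -
    have "sqrt (sqrt a) ^ 4 = a" "sqrt a ^ 4 = a\<^sup>2" if "a \<ge> 0" for a :: real
      using that power_mult[of "sqrt (sqrt a)" 2 2] power_mult[of "sqrt a" 2 2] by simp_all
    then show ?thesis using \<beta> N unfolding power_mult_distrib by simp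
  qed
  finally have "u - v \<le> sqrt (sqrt (24 / \<beta>)) * sqrt N"
    by (rule power_le_imp_le_base[where n=3, simplified]) (use \<beta> N in auto)
  moreover have "real_of_int \<bar>fst m - fst m'\<bar> \<le> 2 * real_of_int \<bar>fst m - fst m'\<bar>" by simp
  ultimately show ?thesis unfolding uv by (rule order.trans[rotated])
qed

text \<open>The two points are exchanged if necessary, since the asymmetric version needs the size
  bound at the point with the smaller |p|.\<close>

lemma resonance_first_coordinate:
  assumes \<beta>: "\<beta> > 0" and N: "N \<ge> 1"
    and size: "size1 m \<le> N" "size1 (k - m) \<le> N" "size1 m' \<le> N" "size1 (k - m') \<le> N"
    and near: "\<bar>(disp \<beta> m + disp \<beta> (k - m)) - (disp \<beta> m' + disp \<beta> (k - m'))\<bar> < 1"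
    and sign: "2 * fst m - fst k \<ge> 0 \<longleftrightarrow> 2 * fst m' - fst k \<ge> 0"
  shows "real_of_int \<bar>fst m - fst m'\<bar> \<le> sqrt (sqrt (24 / \<beta>)) * sqrt N"
proof (cases "\<bar>2 * fst m' - fst k\<bar> \<le> \<bar>2 * fst m - fst k\<bar>")
  case True
  show ?thesis by (rule resonance_first_coordinate_aux[OF \<beta> N size(3,4) near sign True])
next
  case False
  then have "\<bar>2 * fst m - fst k\<bar> \<le> \<bar>2 * fst m' - fst k\<bar>" by simp
  then have "real_of_int \<bar>fst m' - fst m\<bar> \<le> sqrt (sqrt (24 / \<beta>)) * sqrt N"
    using near by (intro resonance_first_coordinate_aux[OF \<beta> N size(1,2) _ sign[symmetric]])
      (simp_all only: abs_minus_commute)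
  then show ?thesis by (simp only: abs_minus_commute)
qed

text \<open>q and q' share the parity of k2, so two distinct ones of the same sign differ in
  absolute value by at least 2. Then q^2 and q'^2 differ by at least 4, and half of that exceeds the
  window length 1.\<close>

lemma resonance_second_coordinate:
  assumes near: "\<bar>(disp \<beta> m + disp \<beta> (k - m)) - (disp \<beta> m' + disp \<beta> (k - m'))\<bar> < 1"
    and fst: "fst m = fst m'"
    and sign: "2 * snd m - snd k \<ge> 0 \<longleftrightarrow> 2 * snd m' - snd k \<ge> 0"
  shows "m = m'"
proof (rule ccontr)
  assume "m \<noteq> m'"
  then have ne: "snd m \<noteq> snd m'" using fst by (simp add: prod_eq_iff)
  define q q' where "q = \<bar>2 * snd m - snd k\<bar>" "q' = \<bar>2 * snd m' - snd k\<bar>"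
  have "(disp \<beta> m + disp \<beta> (k - m)) - (disp \<beta> m' + disp \<beta> (k - m'))
      = real_of_int (q\<^sup>2 - q'\<^sup>2) / 2"
    unfolding disp_add_disp_reflect fst q_q'_def by (simp add: field_simps)
  then have "\<bar>real_of_int (q\<^sup>2 - q'\<^sup>2)\<bar> < 2" using near by simp
  then have "\<bar>q\<^sup>2 - q'\<^sup>2\<bar> < 2" by linarith
  moreover have "q\<^sup>2 - q'\<^sup>2 = (q - q') * (q + q')" by (simp add: power2_eq_square algebra_simps)
  moreover have "\<bar>q - q'\<bar> \<ge> 2" using ne sign unfolding q_q'_def by linarith
  moreover have "q + q' \<ge> \<bar>q - q'\<bar>" unfolding q_q'_def by linarith
  then have "\<bar>q - q'\<bar> * \<bar>q + q'\<bar> \<ge> 2 * 2"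
    using \<open>\<bar>q - q'\<bar> \<ge> 2\<close> by (intro mult_mono) auto
  ultimately show False by (simp add: abs_mult)
qed

lemma finite_size1_le: "finite {n. size1 n \<le> N}"
proof (rule finite_subset)
  show "{n. size1 n \<le> N} \<subseteq> {- \<lceil>N\<rceil>..\<lceil>N\<rceil>} \<times> {- \<lceil>N\<rceil>..\<lceil>N\<rceil>}"
  proof
    fix n assume "n \<in> {n. size1 n \<le> N}"
    then have "\<bar>real_of_int (fst n)\<bar> \<le> N" "\<bar>real_of_int (snd n)\<bar> \<le> N" by (auto simp: size1_def)
    then have "\<bar>fst n\<bar> \<le> \<lceil>N\<rceil>" "\<bar>snd n\<bar> \<le> \<lceil>N\<rceil>" by linarith+
    then show "n \<in> {- \<lceil>N\<rceil>..\<lceil>N\<rceil>} \<times> {- \<lceil>N\<rceil>..\<lceil>N\<rceil>}"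
      by (cases n) auto
  qed
qed auto

text \<open>Split by the signs of p and q. On each of the four classes the first coordinate
  determines the second, and the first coordinates lie in an interval of length O(sqrt N). The + 1
  from counting both endpoints is absorbed by N \<ge> 1.\<close>

lemma resonance_count:
  assumes \<beta>: "\<beta> > 0" and N: "N \<ge> 1"
    and size: "\<And>m. m \<in> X \<Longrightarrow> size1 m \<le> N \<and> size1 (k - m) \<le> N"
    and near: "\<And>m m'. m \<in> X \<Longrightarrow> m' \<in> X \<Longrightarrow>
      \<bar>(disp \<beta> m + disp \<beta> (k - m)) - (disp \<beta> m' + disp \<beta> (k - m'))\<bar> < 1"
  shows "real (card X) \<le> 4 * (sqrt (sqrt (24 / \<beta>)) + 1) * sqrt N"
proof -
  have fin: "finite X" by (rule finite_subset[OF _ finite_size1_le[of N]]) (use size in auto)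
  define P where "P s s' = {m\<in>X. (2 * fst m - fst k \<ge> 0) = s \<and> (2 * snd m - snd k \<ge> 0) = s'}" for s s'
  let ?D = "sqrt (sqrt (24 / \<beta>)) * sqrt N"
  have P: "real (card (P s s')) \<le> ?D + 1" for s s'
  proof -
    have "inj_on fst (P s s')"
    proof (rule inj_onI)
      fix m m' assume "m \<in> P s s'" "m' \<in> P s s'" "fst m = fst m'"
      then show "m = m'"
        by (intro resonance_second_coordinate[OF near]) (auto simp: P_def)
    qed
    then have "card (P s s') = card (fst ` P s s')" by (simp add: card_image)
    also have "real \<dots> \<le> ?D + 1"
    proof (rule card_int_le_diameter)
      fix x y assume "x \<in> fst ` P s s'" "y \<in> fst ` P s s'"
      then obtain m m' where xy: "x = fst m" "y = fst m'" and mP: "m \<in> P s s'" "m' \<in> P s s'" by blast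
      then have X: "m \<in> X" "m' \<in> X" and sign: "2 * fst m - fst k \<ge> 0 \<longleftrightarrow> 2 * fst m' - fst k \<ge> 0"
        by (auto simp: P_def)
      show "real_of_int \<bar>x - y\<bar> \<le> ?D"
        unfolding xy using size[OF X(1)] size[OF X(2)]
        by (intro resonance_first_coordinate[OF \<beta> N _ _ _ _ near[OF X] sign]) simp_all
    qed (use fin \<beta> N in \<open>auto simp: P_def\<close>)
    finally show ?thesis .
  qed
  have "X = P True True \<union> P True False \<union> P False True \<union> P False False" by (auto simp: P_def)
  from arg_cong[OF this, of card]
  have "card X \<le> card (P True True) + card (P True False) + card (P False True) + card (P False False)"
    using card_Un_le[of "P True True \<union> P True False \<union> P False True" "P False False"]
      card_Un_le[of "P True True \<union> P True False" "P False True"]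
      card_Un_le[of "P True True" "P True False"] by linarith
  then have "real (card X) \<le> real (card (P True True)) + real (card (P True False)) + real (card (P False True)) + real (card (P False False))"
    by linarith
  also have "\<dots> \<le> (?D + 1) + (?D + 1) + (?D + 1) + (?D + 1)"
    by (intro add_mono P)
  also have "\<dots> = 4 * (?D + 1)" by simp
  also have "\<dots> \<le> 4 * (?D + sqrt N)" using N by simp
  finally show ?thesis by (simp add: algebra_simps)
qed

section \<open>The estimate on a frequency block\<close>

definition sumset :: "(int \<times> int) set \<Rightarrow> (int \<times> int) set" where
  "sumset F = (\<lambda>(m, n). m + n) ` (F \<times> F)"

definition fibre :: "(int \<times> int) set \<Rightarrow> int \<times> int \<Rightarrow> (int \<times> int) set" where
  "fibre F k = {m\<in>F. k - m \<in> F}"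

lemma finite_sumset: "finite F \<Longrightarrow> finite (sumset F)"
  by (simp add: sumset_def)

lemma finite_fibre: "finite F \<Longrightarrow> finite (fibre F k)"
  by (simp add: fibre_def)

text \<open>A pair is recovered from its sum and its first entry. This sorts the square of a
  trigonometric sum by output frequency, and read backwards it factorises the final double
  sum.\<close>

lemma sum_sumset_fibre:
  assumes "finite F"
  shows "(\<Sum>k\<in>sumset F. \<Sum>m\<in>fibre F k. f m (k - m)) = (\<Sum>m\<in>F. \<Sum>n\<in>F. f m n)"
proof -
  have "(\<Sum>k\<in>sumset F. \<Sum>m\<in>fibre F k. f m (k - m))
      = (\<Sum>(k, m)\<in>Sigma (sumset F) (fibre F). f m (k - m))"
    using assms by (intro sum.Sigma) (auto simp: finite_sumset finite_fibre)
  also have "\<dots> = (\<Sum>(m, n)\<in>F \<times> F. f m n)"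
    by (rule sum.reindex_bij_witness[where i="\<lambda>(m, n). (m + n, m)" and j="\<lambda>(k, m). (m, k - m)"])
       (auto simp: sumset_def fibre_def image_iff)
  finally show ?thesis by (simp add: sum.cartesian_product)
qed

lemma trig_poly_squared:
  assumes "finite F"
  shows "(trig_poly c F z)\<^sup>2 = trig_poly (\<lambda>k. \<Sum>m\<in>fibre F k. c m * c (k - m)) (sumset F) z"
proof -
  have "(trig_poly c F z)\<^sup>2 = (\<Sum>m\<in>F. \<Sum>n\<in>F. (c m * tchar m z) * (c n * tchar n z))"
    by (simp add: trig_poly_def power2_eq_square sum_product)
  also have "\<dots> = (\<Sum>k\<in>sumset F. \<Sum>m\<in>fibre F k. (c m * tchar m z) * (c (k - m) * tchar (k - m) z))"
    by (rule sum_sumset_fibre[OF assms, symmetric])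
  also have "\<dots> = (\<Sum>k\<in>sumset F. \<Sum>m\<in>fibre F k. c m * c (k - m) * tchar k z)"
  proof (intro sum.cong refl)
    fix k m
    have "tchar k z = tchar m z * tchar (k - m) z" by (simp flip: tchar_add)
    then show "(c m * tchar m z) * (c (k - m) * tchar (k - m) z) = c m * c (k - m) * tchar k z"
      by (simp add: mult_ac)
  qed
  finally show ?thesis by (simp add: trig_poly_def sum_distrib_right)
qed

lemma nn_integral_norm_trig_poly_power4:
  assumes "finite F"
  shows "(\<integral>\<^sup>+z. ennreal (norm (trig_poly c F z) ^ 4) \<partial>torus2)
    = ennreal ((2 * pi)\<^sup>2 * (\<Sum>k\<in>sumset F. (norm (\<Sum>m\<in>fibre F k. c m * c (k - m)))\<^sup>2))"
proof -
  have "norm (trig_poly c F z) ^ 4 = (norm ((trig_poly c F z)\<^sup>2))\<^sup>2" for z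
    by (simp add: norm_power)
  then show ?thesis
    unfolding trig_poly_squared[OF assms]
    using nn_integral_norm_trig_poly_squared[OF finite_sumset[OF assms]] by simp
qed

section \<open>Time evolution and iterated integrals over space-time\<close>

definition evolve :: "real \<Rightarrow> real \<Rightarrow> (int \<times> int \<Rightarrow> complex) \<Rightarrow> int \<times> int \<Rightarrow> complex" where
  "evolve \<beta> t c n = cis (- t * disp \<beta> n) * c n"

lemma norm_evolve [simp]: "norm (evolve \<beta> t c n) = norm (c n)"
  by (simp add: evolve_def norm_mult)

lemma fst_measurable_spacetime [measurable]: "fst \<in> borel_measurable (spacetime I)"
proof -
  have "(\<lambda>t. t) \<in> borel_measurable (restrict_space lborel I)"
    by (rule measurable_restrict_space1) simp
  from measurable_compose[OF measurable_fst this] show ?thesis by (simp add: spacetime_def)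
qed

lemma snd_measurable_spacetime [measurable]: "snd \<in> measurable (spacetime I) torus2"
  by (simp add: spacetime_def)

lemma trig_poly_evolve_measurable [measurable]:
  "(\<lambda>p. trig_poly (evolve \<beta> (fst p) c) F (snd p)) \<in> borel_measurable (spacetime I)"
  unfolding trig_poly_def evolve_def by measurable

lemma norm_power4_trig_poly_evolve_measurable:
  "(\<lambda>p. ennreal (norm (trig_poly (evolve \<beta> (fst p) c) F (snd p)) ^ 4)) \<in> borel_measurable (spacetime I)"
  by (rule measurable_compose[OF trig_poly_evolve_measurable, of "\<lambda>w. ennreal (norm w ^ 4)"]) measurable

lemma nn_integral_spacetime:
  assumes "f \<in> borel_measurable (spacetime I)" and I: "I \<in> sets borel"
  shows "(\<integral>\<^sup>+p. f p \<partial>spacetime I) = (\<integral>\<^sup>+t. (\<integral>\<^sup>+z. f (t, z) \<partial>torus2) * indicator I t \<partial>lborel)"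
proof -
  have "(\<integral>\<^sup>+p. f p \<partial>spacetime I) = (\<integral>\<^sup>+t. \<integral>\<^sup>+z. f (t, z) \<partial>torus2 \<partial>restrict_space lborel I)"
    using assms(1) unfolding spacetime_def by (rule torus2.nn_integral_fst[symmetric])
  also have "\<dots> = (\<integral>\<^sup>+t. (\<integral>\<^sup>+z. f (t, z) \<partial>torus2) * indicator I t \<partial>lborel)"
    using I by (intro nn_integral_restrict_space) simp
  finally show ?thesis .
qed

lemma integrable_bump_exponential_sum:
  fixes A :: "'a \<Rightarrow> complex"
  shows "integrable lborel (\<lambda>t. indicator {-L..L} t * ((L\<^sup>2 - t\<^sup>2) * (norm (\<Sum>x\<in>X. A x * cis (\<mu> x * t)))\<^sup>2))"
proof -
  have "set_integrable lborel {-L..L} (\<lambda>t. (L\<^sup>2 - t\<^sup>2) * (norm (\<Sum>x\<in>X. A x * cis (\<mu> x * t)))\<^sup>2)"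
    unfolding cis_conv_exp by (intro borel_integrable_atLeastAtMost' continuous_intros)
  then show ?thesis by (simp add: set_integrable_def)
qed

text \<open>For each sum frequency \<open>k\<close> the almost orthogonality bound applies with
  \<open>B\<close> given by the resonance count. Summing over \<open>k\<close> and its fibre yields
  the square of the l^2 mass.\<close>

lemma block_estimate:
  assumes \<beta>: "\<beta> > 0" and R: "R > 0" and I: "I \<in> sets borel" "I \<subseteq> {-R..R}"
  obtains C where "C > 0"
    "\<And>N F c. N \<ge> 1 \<Longrightarrow> finite F \<Longrightarrow> (\<And>n. n \<in> F \<Longrightarrow> size1 n \<le> N) \<Longrightarrow>
      (\<integral>\<^sup>+p. ennreal (norm (trig_poly (evolve \<beta> (fst p) c) F (snd p)) ^ 4) \<partial>spacetime I)
        \<le> ennreal (C * sqrt N * (\<Sum>n\<in>F. (norm (c n))\<^sup>2)\<^sup>2)"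
proof -
  \<comment> \<open>On [-R, R] the weight with L = 2 R is at least 3 R^2; dividing by the cruder R^2
    in \<open>P\<close> removes it.\<close>
  define L where "L = 2 * R"
  have L: "L > 0" using R by (simp add: L_def)
  obtain Q where Q: "Q > 0" and Qbound:
    "\<And>(X :: (int \<times> int) set) A \<mu> B. finite X \<Longrightarrow> (\<And>l::int. real (card {x\<in>X. \<lfloor>\<mu> x\<rfloor> = l}) \<le> B) \<Longrightarrow>
      (LINT t|lborel. indicator {-L..L} t * ((L\<^sup>2 - t\<^sup>2) * (norm (\<Sum>x\<in>X. A x * cis (\<mu> x * t)))\<^sup>2))
        \<le> Q * B * (\<Sum>x\<in>X. (norm (A x))\<^sup>2)"
    using exponential_sum_L2_bound[OF L] by blast
  define C1 where "C1 = 4 * (sqrt (sqrt (24 / \<beta>)) + 1)"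
  have C1: "C1 > 0" using \<beta> by (simp add: C1_def add_nonneg_pos)
  define P where "P = (2 * pi)\<^sup>2 / R\<^sup>2"
  have P: "P > 0" using R by (simp add: P_def)
  show ?thesis
  proof (rule that[of "P * Q * C1"])
    show "P * Q * C1 > 0" using P Q C1 by simp
    fix N :: real and F and c :: "int \<times> int \<Rightarrow> complex"
    assume N: "N \<ge> 1" and F: "finite F" and size: "\<And>n. n \<in> F \<Longrightarrow> size1 n \<le> N"
    define \<mu> where "\<mu> k m = - (disp \<beta> m + disp \<beta> (k - m))" for k m
    define D where "D k t = (\<Sum>m\<in>fibre F k. c m * c (k - m) * cis (\<mu> k m * t))" for k t
    define h where "h k t = indicator {-L..L} t * ((L\<^sup>2 - t\<^sup>2) * (norm (D k t))\<^sup>2)" for k t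
    have h0: "h k t \<ge> 0" for k t
    proof (cases "t \<in> {-L..L}")
      case True
      then have "t\<^sup>2 \<le> L\<^sup>2" by (intro abs_le_square_iff[THEN iffD1]) auto
      then show ?thesis using True by (simp add: h_def)
    qed (simp add: h_def)
    have hint: "integrable lborel (h k)" for k
      unfolding h_def D_def by (rule integrable_bump_exponential_sum)
    have hbound: "integral\<^sup>L lborel (h k) \<le> Q * (C1 * sqrt N) * (\<Sum>m\<in>fibre F k. (norm (c m))\<^sup>2 * (norm (c (k - m)))\<^sup>2)" for k
    proof -
      have "integral\<^sup>L lborel (h k) \<le> Q * (C1 * sqrt N) * (\<Sum>m\<in>fibre F k. (norm (c m * c (k - m)))\<^sup>2)"
        unfolding h_def D_def
      proof (rule Qbound[OF finite_fibre[OF F]])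
        fix l :: int
        show "real (card {m\<in>fibre F k. \<lfloor>\<mu> k m\<rfloor> = l}) \<le> C1 * sqrt N"
          unfolding C1_def
        proof (rule resonance_count[OF \<beta> N, where k=k])
          fix m m' assume "m \<in> {m\<in>fibre F k. \<lfloor>\<mu> k m\<rfloor> = l}" "m' \<in> {m\<in>fibre F k. \<lfloor>\<mu> k m\<rfloor> = l}"
          then have "\<lfloor>\<mu> k m\<rfloor> = \<lfloor>\<mu> k m'\<rfloor>" by simp
          then have "\<bar>\<mu> k m - \<mu> k m'\<bar> < 1" by linarith
          then show "\<bar>(disp \<beta> m + disp \<beta> (k - m)) - (disp \<beta> m' + disp \<beta> (k - m'))\<bar> < 1"
            unfolding \<mu>_def by linarith
        qed (use size in \<open>auto simp: fibre_def\<close>)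
      qed
      then show ?thesis by (simp only: norm_mult power_mult_distrib)
    qed
    have "(\<integral>\<^sup>+p. ennreal (norm (trig_poly (evolve \<beta> (fst p) c) F (snd p)) ^ 4) \<partial>spacetime I)
        = (\<integral>\<^sup>+t. (\<integral>\<^sup>+z. ennreal (norm (trig_poly (evolve \<beta> t c) F z) ^ 4) \<partial>torus2) * indicator I t \<partial>lborel)"
      by (subst nn_integral_spacetime[OF norm_power4_trig_poly_evolve_measurable I(1)]) simp
    also have "\<dots> \<le> (\<integral>\<^sup>+t. ennreal (P * (\<Sum>k\<in>sumset F. h k t)) \<partial>lborel)"
    proof (rule nn_integral_mono)
      fix t
      have D: "(\<Sum>m\<in>fibre F k. evolve \<beta> t c m * evolve \<beta> t c (k - m)) = D k t" for k
        unfolding D_def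
      proof (intro sum.cong refl)
        fix m
        have "cis (\<mu> k m * t) = cis (- t * disp \<beta> m) * cis (- t * disp \<beta> (k - m))"
          by (simp add: cis_mult \<mu>_def algebra_simps)
        then show "evolve \<beta> t c m * evolve \<beta> t c (k - m) = c m * c (k - m) * cis (\<mu> k m * t)"
          by (simp add: evolve_def mult_ac)
      qed
      show "(\<integral>\<^sup>+z. ennreal (norm (trig_poly (evolve \<beta> t c) F z) ^ 4) \<partial>torus2) * indicator I t
          \<le> ennreal (P * (\<Sum>k\<in>sumset F. h k t))"
      proof (cases "t \<in> I")
        case True
        then have t: "-R \<le> t" "t \<le> R" using I by auto
        then have "t\<^sup>2 \<le> R\<^sup>2" by (intro abs_le_square_iff[THEN iffD1]) auto
        also have "\<dots> \<le> 3 * R\<^sup>2" by simp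
        finally have Lt: "R\<^sup>2 \<le> L\<^sup>2 - t\<^sup>2" by (simp add: L_def power_mult_distrib)
        have tL: "t \<in> {-L..L}" using t R by (auto simp: L_def)
        have "(2 * pi)\<^sup>2 * (norm (D k t))\<^sup>2 \<le> P * h k t" for k
        proof -
          have "(2 * pi)\<^sup>2 * (norm (D k t))\<^sup>2 = P * (R\<^sup>2 * (norm (D k t))\<^sup>2)"
            using R by (simp add: P_def)
          also have "\<dots> \<le> P * ((L\<^sup>2 - t\<^sup>2) * (norm (D k t))\<^sup>2)"
            using P Lt by (intro mult_left_mono mult_right_mono) auto
          finally show ?thesis using tL by (simp add: h_def)
        qed
        then have "(2 * pi)\<^sup>2 * (\<Sum>k\<in>sumset F. (norm (D k t))\<^sup>2) \<le> P * (\<Sum>k\<in>sumset F. h k t)"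
          unfolding sum_distrib_left by (rule sum_mono)
        then show ?thesis
          using True by (simp add: nn_integral_norm_trig_poly_power4[OF F] D ennreal_leI)
      qed simp
    qed
    also have "\<dots> = ennreal (LINT t|lborel. P * (\<Sum>k\<in>sumset F. h k t))"
      using P h0 hint by (intro nn_integral_eq_integral) (auto intro!: mult_nonneg_nonneg sum_nonneg)
    also have "(LINT t|lborel. P * (\<Sum>k\<in>sumset F. h k t)) = P * (\<Sum>k\<in>sumset F. integral\<^sup>L lborel (h k))"
      using hint by simp
    also have "\<dots> \<le> P * (\<Sum>k\<in>sumset F. Q * (C1 * sqrt N) * (\<Sum>m\<in>fibre F k. (norm (c m))\<^sup>2 * (norm (c (k - m)))\<^sup>2))"
      using P by (intro mult_left_mono sum_mono hbound) auto
    also have "\<dots> = P * (Q * (C1 * sqrt N) * (\<Sum>m\<in>F. \<Sum>n\<in>F. (norm (c m))\<^sup>2 * (norm (c n))\<^sup>2))"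
      unfolding sum_sumset_fibre[OF F, symmetric] by (simp only: sum_distrib_left[symmetric])
    also have "\<dots> = P * Q * C1 * sqrt N * (\<Sum>n\<in>F. (norm (c n))\<^sup>2)\<^sup>2"
      by (simp only: power2_eq_square[of "sum _ _"] sum_product mult.assoc)
    finally show "(\<integral>\<^sup>+p. ennreal (norm (trig_poly (evolve \<beta> (fst p) c) F (snd p)) ^ 4) \<partial>spacetime I)
        \<le> ennreal (P * Q * C1 * sqrt N * (\<Sum>n\<in>F. (norm (c n))\<^sup>2)\<^sup>2)"
      by (simp add: ennreal_leI)
  qed
qed

section \<open>Dyadic summation\<close>

lemma sum_squared_le_weighted:
  fixes a r :: "'a \<Rightarrow> real"
  assumes r: "\<And>j. r j > 0"
  shows "(\<Sum>j\<in>J. a j)\<^sup>2 \<le> (\<Sum>j\<in>J. r j) * (\<Sum>j\<in>J. (a j)\<^sup>2 / r j)"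
proof -
  have "(\<Sum>j\<in>J. a j)\<^sup>2 = (\<Sum>j\<in>J. sqrt (r j) * (a j / sqrt (r j)))\<^sup>2"
    using r by (simp add: less_imp_neq[THEN not_sym])
  also have "\<dots> \<le> (\<Sum>j\<in>J. (sqrt (r j))\<^sup>2) * (\<Sum>j\<in>J. (a j / sqrt (r j))\<^sup>2)"
    by (rule Cauchy_Schwarz_ineq_sum)
  also have "\<dots> = (\<Sum>j\<in>J. r j) * (\<Sum>j\<in>J. (a j)\<^sup>2 / r j)"
    using r by (simp add: power_divide less_imp_le)
  finally show ?thesis .
qed

text \<open>Two applications of Cauchy-Schwarz with the same weights, that is, Hoelder with
  exponents 4 and 4/3. Geometric weights make the cost independent of the number of terms.\<close>

lemma sum_power4_le_weighted:
  fixes a r :: "'a \<Rightarrow> real"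
  assumes r: "\<And>j. r j > 0"
  shows "(\<Sum>j\<in>J. a j) ^ 4 \<le> (\<Sum>j\<in>J. r j) ^ 3 * (\<Sum>j\<in>J. a j ^ 4 / r j ^ 3)"
proof -
  let ?R = "\<Sum>j\<in>J. r j" and ?A = "\<Sum>j\<in>J. (a j)\<^sup>2 / r j"
  have R: "?R \<ge> 0" and A: "?A \<ge> 0" using r by (auto intro!: sum_nonneg simp: less_imp_le)
  have "(\<Sum>j\<in>J. a j) ^ 4 = ((\<Sum>j\<in>J. a j)\<^sup>2)\<^sup>2" by simp
  also have "\<dots> \<le> (?R * ?A)\<^sup>2"
    by (intro power_mono sum_squared_le_weighted r) simp
  also have "\<dots> = ?R\<^sup>2 * ?A\<^sup>2" by (rule power_mult_distrib)
  also have "\<dots> \<le> ?R\<^sup>2 * (?R * (\<Sum>j\<in>J. ((a j)\<^sup>2 / r j)\<^sup>2 / r j))"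
    by (intro mult_left_mono sum_squared_le_weighted r) simp
  also have "(\<Sum>j\<in>J. ((a j)\<^sup>2 / r j)\<^sup>2 / r j) = (\<Sum>j\<in>J. a j ^ 4 / r j ^ 3)"
    by (simp add: power_divide power2_eq_square power3_eq_cube power4_eq_xxxx mult_ac)
  finally show ?thesis by (simp add: power2_eq_square power3_eq_cube mult_ac)
qed

lemma size1_ge_1: "size1 n \<ge> 1"
  by (simp add: size1_def)

definition dyadic_level :: "int \<times> int \<Rightarrow> nat" where
  "dyadic_level n = nat \<lfloor>log 2 (size1 n)\<rfloor>"

lemma dyadic_level: "2 ^ dyadic_level n \<le> size1 n" "size1 n \<le> 2 * 2 ^ dyadic_level n"
proof -
  have pos: "size1 n > 0" and log: "log 2 (size1 n) \<ge> 0" using size1_ge_1[of n] by auto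
  then have eq: "real (dyadic_level n) = of_int \<lfloor>log 2 (size1 n)\<rfloor>"
    by (simp add: dyadic_level_def)
  have "2 powr real (dyadic_level n) \<le> 2 powr (log 2 (size1 n))"
    unfolding eq by (intro powr_mono) auto
  then show "2 ^ dyadic_level n \<le> size1 n" using pos by (simp add: powr_realpow)
  have "2 powr (log 2 (size1 n)) \<le> 2 powr (real (dyadic_level n) + 1)"
    unfolding eq by (intro powr_mono) linarith+
  then show "size1 n \<le> 2 * 2 ^ dyadic_level n" using pos by (simp add: powr_realpow powr_add)
qed

text \<open>On level j the fourth power of the damping, 2^(-j/2 - 4 epsilon j), cancels the block
  loss 2^(j/2) and leaves rho^(4j). The Hoelder weights rho^j cost a factor rho^(-3j), so rho^j
  remains and is summable: \<open>K\<close> cubed comes from the weights and a fourth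
  \<open>K\<close> from this last sum.\<close>

lemma trig_poly_strichartz:
  assumes \<beta>: "\<beta> > 0" and R: "R > 0" and I: "I \<in> sets borel" "I \<subseteq> {-R..R}" and \<epsilon>: "\<epsilon> > 0"
  obtains C where "C > 0"
    "\<And>F a. finite F \<Longrightarrow>
      (\<integral>\<^sup>+p. ennreal (norm (trig_poly (evolve \<beta> (fst p) (\<lambda>n. of_real (size1 n powr - (1/8 + \<epsilon>)) * a n)) F (snd p)) ^ 4) \<partial>spacetime I)
        \<le> ennreal (C * (\<Sum>n\<in>F. (norm (a n))\<^sup>2)\<^sup>2)"
proof -
  obtain C where C: "C > 0" and block:
    "\<And>N F c. N \<ge> 1 \<Longrightarrow> finite F \<Longrightarrow> (\<And>n. n \<in> F \<Longrightarrow> size1 n \<le> N) \<Longrightarrow>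
      (\<integral>\<^sup>+p. ennreal (norm (trig_poly (evolve \<beta> (fst p) c) F (snd p)) ^ 4) \<partial>spacetime I)
        \<le> ennreal (C * sqrt N * (\<Sum>n\<in>F. (norm (c n))\<^sup>2)\<^sup>2)"
    using block_estimate[OF \<beta> R I] by blast
  define \<rho> where "\<rho> = 2 powr - \<epsilon>"
  have \<rho>: "0 < \<rho>" "\<rho> < 1" using \<epsilon> powr_less_mono[of "-\<epsilon>" 0 2] by (auto simp: \<rho>_def)
  define K where "K = 1 / (1 - \<rho>)"
  have K: "K > 0" using \<rho> by (simp add: K_def)
  have geo: "(\<Sum>j\<in>J. \<rho> ^ j) \<le> K" if "finite J" for J
  proof -
    have "(\<Sum>j\<in>J. \<rho> ^ j) \<le> (\<Sum>j. \<rho> ^ j)"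
      by (rule sum_le_suminf) (use that \<rho> in \<open>auto intro: summable_geometric\<close>)
    then show ?thesis using \<rho> by (simp add: K_def suminf_geometric)
  qed
  show ?thesis
  proof (rule that[of "K ^ 4 * (C * sqrt 2)"])
    show "K ^ 4 * (C * sqrt 2) > 0" using K C by simp
    fix F :: "(int \<times> int) set" and a :: "int \<times> int \<Rightarrow> complex"
    assume F: "finite F"
    define S where "S = (\<Sum>n\<in>F. (norm (a n))\<^sup>2)"
    have S: "S \<ge> 0" by (simp add: S_def sum_nonneg)
    define c where "c n = of_real (size1 n powr - (1/8 + \<epsilon>)) * a n" for n
    define J where "J = dyadic_level ` F"
    define E where "E j = {n\<in>F. dyadic_level n = j}" for j
    have J: "finite J" and E: "finite (E j)" for j using F by (auto simp: J_def E_def)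
    let ?U = "\<lambda>G p. norm (trig_poly (evolve \<beta> (fst p) c) G (snd p))"
    have piece: "(\<integral>\<^sup>+p. ennreal (?U (E j) p ^ 4) \<partial>spacetime I) \<le> ennreal (C * sqrt 2 * S\<^sup>2 * (\<rho> ^ j) ^ 4)" for j
    proof -
      let ?M = "2 ^ j :: real"
      have M: "?M \<ge> 1" by simp
      \<comment> \<open>The damping is bounded by its value at the lower end 2^j of the level; the
        block bound is applied at the upper end 2^(j+1), which is where \<open>sqrt 2\<close> comes
        from.\<close>
      have w: "(norm (c n))\<^sup>2 \<le> ?M powr - (1/4 + 2 * \<epsilon>) * (norm (a n))\<^sup>2" if "n \<in> E j" for n
      proof -
        have "?M \<le> size1 n" using that dyadic_level[of n] by (auto simp: E_def)
        then have "size1 n powr - (1/8 + \<epsilon>) \<le> ?M powr - (1/8 + \<epsilon>)"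
          using \<epsilon> by (intro powr_mono2') auto
        then have "(size1 n powr - (1/8 + \<epsilon>))\<^sup>2 \<le> (?M powr - (1/8 + \<epsilon>))\<^sup>2"
          by (intro power_mono) auto
        also have "\<dots> = ?M powr - (1/4 + 2 * \<epsilon>)"
          by (simp add: power2_eq_square powr_add[symmetric] algebra_simps)
        finally show ?thesis
          by (simp add: c_def norm_mult power_mult_distrib mult_right_mono)
      qed
      have "(\<Sum>n\<in>E j. (norm (c n))\<^sup>2) \<le> (\<Sum>n\<in>E j. ?M powr - (1/4 + 2 * \<epsilon>) * (norm (a n))\<^sup>2)"
        by (rule sum_mono[OF w])
      also have "\<dots> = ?M powr - (1/4 + 2 * \<epsilon>) * (\<Sum>n\<in>E j. (norm (a n))\<^sup>2)"
        by (simp add: sum_distrib_left)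
      \<comment> \<open>Each level is bounded by the total mass \<open>S\<close>; the geometric
        factor alone provides summability over levels.\<close>
      also have "\<dots> \<le> ?M powr - (1/4 + 2 * \<epsilon>) * S"
        unfolding S_def by (intro mult_left_mono sum_mono2 F) (auto simp: E_def)
      finally have "(\<Sum>n\<in>E j. (norm (c n))\<^sup>2)\<^sup>2 \<le> (?M powr - (1/4 + 2 * \<epsilon>) * S)\<^sup>2"
        by (intro power_mono) (auto intro: sum_nonneg)
      also have "\<dots> = ?M powr - (1/2 + 4 * \<epsilon>) * S\<^sup>2"
        by (simp add: power_mult_distrib) (simp add: power2_eq_square powr_add[symmetric] algebra_simps)
      finally have "C * sqrt (2 * ?M) * (\<Sum>n\<in>E j. (norm (c n))\<^sup>2)\<^sup>2
          \<le> C * sqrt (2 * ?M) * (?M powr - (1/2 + 4 * \<epsilon>) * S\<^sup>2)"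
        using C by (intro mult_left_mono) auto
      also have "\<dots> = C * sqrt 2 * S\<^sup>2 * (?M powr (1/2) * ?M powr - (1/2 + 4 * \<epsilon>))"
        by (simp add: real_sqrt_mult powr_half_sqrt)
      also have "?M powr (1/2) * ?M powr - (1/2 + 4 * \<epsilon>) = (\<rho> ^ j) ^ 4"
      proof -
        have "?M powr (1/2) * ?M powr - (1/2 + 4 * \<epsilon>) = ?M powr (- 4 * \<epsilon>)"
          by (simp add: powr_add[symmetric])
        also have "\<dots> = (2 powr real j) powr (- 4 * \<epsilon>)" by (simp add: powr_realpow)
        also have "\<dots> = (2 powr - \<epsilon>) powr (real (j * 4))" by (simp add: powr_powr mult_ac)
        also have "\<dots> = \<rho> ^ (j * 4)" unfolding \<rho>_def by (rule powr_realpow) simp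
        finally show ?thesis by (simp add: power_mult)
      qed
      finally have *: "C * sqrt (2 * ?M) * (\<Sum>n\<in>E j. (norm (c n))\<^sup>2)\<^sup>2 \<le> C * sqrt 2 * S\<^sup>2 * (\<rho> ^ j) ^ 4" .
      have "(\<integral>\<^sup>+p. ennreal (?U (E j) p ^ 4) \<partial>spacetime I) \<le> ennreal (C * sqrt (2 * ?M) * (\<Sum>n\<in>E j. (norm (c n))\<^sup>2)\<^sup>2)"
      proof (rule block[OF _ E])
        show "1 \<le> 2 * ?M" using M by linarith
        show "size1 n \<le> 2 * ?M" if "n \<in> E j" for n
          using that dyadic_level[of n] by (auto simp: E_def)
      qed
      also have "\<dots> \<le> ennreal (C * sqrt 2 * S\<^sup>2 * (\<rho> ^ j) ^ 4)" by (rule ennreal_leI[OF *])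
      finally show ?thesis .
    qed
    have pw: "?U F p ^ 4 \<le> K ^ 3 * (\<Sum>j\<in>J. ?U (E j) p ^ 4 / (\<rho> ^ j) ^ 3)" for p
    proof -
      have "trig_poly (evolve \<beta> (fst p) c) F (snd p) = (\<Sum>j\<in>J. trig_poly (evolve \<beta> (fst p) c) (E j) (snd p))"
        unfolding trig_poly_def J_def E_def by (rule sum.image_gen[OF F])
      then have "?U F p \<le> (\<Sum>j\<in>J. ?U (E j) p)"
        by (simp add: norm_sum)
      then have "?U F p ^ 4 \<le> (\<Sum>j\<in>J. ?U (E j) p) ^ 4"
        by (intro power_mono) auto
      also have "\<dots> \<le> (\<Sum>j\<in>J. \<rho> ^ j) ^ 3 * (\<Sum>j\<in>J. ?U (E j) p ^ 4 / (\<rho> ^ j) ^ 3)"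
        using \<rho> by (intro sum_power4_le_weighted) auto
      also have "\<dots> \<le> K ^ 3 * (\<Sum>j\<in>J. ?U (E j) p ^ 4 / (\<rho> ^ j) ^ 3)"
        using \<rho> by (intro mult_right_mono power_mono geo J sum_nonneg) auto
      finally show ?thesis .
    qed
    have meas: "(\<lambda>p. ennreal (?U (E j) p ^ 4)) \<in> borel_measurable (spacetime I)" for j
      by (rule norm_power4_trig_poly_evolve_measurable)
    let ?q = "\<lambda>j. K ^ 3 / (\<rho> ^ j) ^ 3"
    have q: "?q j \<ge> 0" for j using K \<rho> by simp
    have "(\<integral>\<^sup>+p. ennreal (?U F p ^ 4) \<partial>spacetime I)
        \<le> (\<integral>\<^sup>+p. (\<Sum>j\<in>J. ennreal (?q j) * ennreal (?U (E j) p ^ 4)) \<partial>spacetime I)"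
    proof (rule nn_integral_mono)
      fix p
      have "ennreal (?U F p ^ 4) \<le> ennreal (\<Sum>j\<in>J. ?q j * ?U (E j) p ^ 4)"
        using pw[of p] by (intro ennreal_leI) (simp add: sum_distrib_left)
      also have "\<dots> = (\<Sum>j\<in>J. ennreal (?q j * ?U (E j) p ^ 4))"
        by (rule sum_ennreal[symmetric]) (rule mult_nonneg_nonneg[OF q], simp)
      also have "\<dots> = (\<Sum>j\<in>J. ennreal (?q j) * ennreal (?U (E j) p ^ 4))"
        by (intro sum.cong refl ennreal_mult q) simp
      finally show "ennreal (?U F p ^ 4) \<le> (\<Sum>j\<in>J. ennreal (?q j) * ennreal (?U (E j) p ^ 4))" .
    qed
    also have "\<dots> = (\<Sum>j\<in>J. ennreal (?q j) * (\<integral>\<^sup>+p. ennreal (?U (E j) p ^ 4) \<partial>spacetime I))"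
      by (subst nn_integral_sum) (auto simp: nn_integral_cmult meas intro!: borel_measurable_times_ennreal)
    also have "\<dots> \<le> (\<Sum>j\<in>J. ennreal (?q j) * ennreal (C * sqrt 2 * S\<^sup>2 * (\<rho> ^ j) ^ 4))"
      by (intro sum_mono mult_left_mono piece) auto
    also have "\<dots> = (\<Sum>j\<in>J. ennreal (K ^ 3 * (C * sqrt 2 * S\<^sup>2) * \<rho> ^ j))"
    proof (intro sum.cong refl)
      fix j
      have "ennreal (?q j) * ennreal (C * sqrt 2 * S\<^sup>2 * (\<rho> ^ j) ^ 4) = ennreal (?q j * (C * sqrt 2 * S\<^sup>2 * (\<rho> ^ j) ^ 4))"
        using q C \<rho> by (intro ennreal_mult[symmetric]) auto
      also have "?q j * (C * sqrt 2 * S\<^sup>2 * (\<rho> ^ j) ^ 4) = K ^ 3 * (C * sqrt 2 * S\<^sup>2) * \<rho> ^ j"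
      proof -
        have "x / y ^ 3 * (z * y ^ 4) = x * z * y" if "y \<noteq> 0" for x y z :: real
          using that by (simp add: field_simps power3_eq_cube power4_eq_xxxx)
        then show ?thesis using \<rho> by simp
      qed
      finally show "ennreal (?q j) * ennreal (C * sqrt 2 * S\<^sup>2 * (\<rho> ^ j) ^ 4) = ennreal (K ^ 3 * (C * sqrt 2 * S\<^sup>2) * \<rho> ^ j)" .
    qed
    also have "\<dots> = ennreal (K ^ 3 * (C * sqrt 2 * S\<^sup>2) * (\<Sum>j\<in>J. \<rho> ^ j))"
      using K C \<rho> by (subst sum_ennreal) (auto simp: sum_distrib_left)
    also have "\<dots> \<le> ennreal (K ^ 3 * (C * sqrt 2 * S\<^sup>2) * K)"
      using K C by (intro ennreal_leI mult_left_mono geo J) auto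
    also have "K ^ 3 * (C * sqrt 2 * S\<^sup>2) * K = K ^ 4 * (C * sqrt 2) * S\<^sup>2"
      by (simp add: power3_eq_cube power4_eq_xxxx)
    finally show "(\<integral>\<^sup>+p. ennreal (norm (trig_poly (evolve \<beta> (fst p) (\<lambda>n. of_real (size1 n powr - (1/8 + \<epsilon>)) * a n)) F (snd p)) ^ 4) \<partial>spacetime I)
        \<le> ennreal (K ^ 4 * (C * sqrt 2) * (\<Sum>n\<in>F. (norm (a n))\<^sup>2)\<^sup>2)"
      unfolding c_def S_def .
  qed
qed

section \<open>The multiplier relations and the theorem\<close>

lemma size1_powr_bounds:
  assumes "\<sigma> \<ge> 0"
  shows "0 \<le> size1 n powr - \<sigma>" "size1 n powr - \<sigma> \<le> 1"
  using powr_mono[of "- \<sigma>" 0 "size1 n"] size1_ge_1[of n] assms by auto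

lemma is_multiplier_image_iff:
  "is_multiplier_image m f g \<longleftrightarrow>
    g \<in> Lp_space 2 torus2 \<and> (\<forall>n. tcoeff g n = m (fst n) (snd n) * tcoeff f n)"
  by (simp add: is_multiplier_image_def)

lemma is_S_flow_iff:
  "is_S_flow \<alpha> t f g \<longleftrightarrow>
    g \<in> Lp_space 2 torus2 \<and> (\<forall>n. tcoeff g n = evolve (- \<alpha>) t (tcoeff f) n)"
proof -
  have "exp (- \<i> * complex_of_real (t * (- \<alpha> * of_int (fst n) ^ 4 + (of_int (snd n))\<^sup>2)))
      = cis (- t * disp (- \<alpha>) n)" for n :: "int \<times> int"
    unfolding cis_conv_exp disp_def by (rule arg_cong[of _ _ exp]) (simp add: algebra_simps)
  then show ?thesis
    unfolding is_S_flow_def is_multiplier_image_iff evolve_def by (simp only:)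
qed

lemma is_D_loss_iff:
  "is_D_loss \<sigma> f g \<longleftrightarrow>
    g \<in> Lp_space 2 torus2 \<and> (\<forall>n. tcoeff g n = of_real (size1 n powr - \<sigma>) * tcoeff f n)"
  unfolding is_D_loss_def is_multiplier_image_iff size1_def by (simp only:)

definition damped :: "real \<Rightarrow> (real \<times> real \<Rightarrow> complex) \<Rightarrow> int \<times> int \<Rightarrow> complex" where
  "damped \<sigma> \<phi> n = of_real (size1 n powr - \<sigma>) * tcoeff \<phi> n"

lemma norm_damped_le: "\<sigma> \<ge> 0 \<Longrightarrow> norm (damped \<sigma> \<phi> n) \<le> norm (tcoeff \<phi> n)"
  using size1_powr_bounds[of \<sigma> n] by (simp add: damped_def norm_mult mult_left_le_one_le)

lemma tcoeff_of_representative: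
  assumes "is_S_flow \<alpha> t \<phi> v" "is_D_loss \<sigma> v g"
  shows "tcoeff g n = evolve (- \<alpha>) t (damped \<sigma> \<phi>) n"
  using assms by (simp add: is_S_flow_iff is_D_loss_iff evolve_def damped_def mult_ac)

text \<open>The exhaustion is fixed by the coefficients of \<open>\<phi>\<close> before t is chosen,
  so the limit is taken along one sequence of jointly measurable functions. The same exhaustion
  produces the witness \<open>v\<close> for the undamped flow.\<close>

lemma representative_exists:
  assumes F: "geometric_exhaustion (tcoeff \<phi>) F" and \<sigma>: "\<sigma> \<ge> 0"
  shows "represents_D_loss_S_flow \<sigma> \<alpha> I \<phi>
    (\<lambda>p. lim (\<lambda>j. trig_poly (evolve (- \<alpha>) (fst p) (damped \<sigma> \<phi>)) (F j) (snd p)))"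
  unfolding represents_D_loss_S_flow_def
proof (intro conjI ballI)
  show "(\<lambda>p. lim (\<lambda>j. trig_poly (evolve (- \<alpha>) (fst p) (damped \<sigma> \<phi>)) (F j) (snd p)))
      \<in> borel_measurable (spacetime I)"
    by (intro borel_measurable_lim_metric trig_poly_evolve_measurable)
  fix t
  define v where "v z = lim (\<lambda>j. trig_poly (evolve (- \<alpha>) t (tcoeff \<phi>)) (F j) z)" for z
  have v: "is_S_flow \<alpha> t \<phi> v"
    unfolding is_S_flow_iff v_def
    using Riesz_Fischer(1,2)[OF F, of "evolve (- \<alpha>) t (tcoeff \<phi>)"] by simp
  have c: "norm (evolve (- \<alpha>) t (damped \<sigma> \<phi>) n) \<le> norm (tcoeff \<phi> n)" for n
    using norm_damped_le[OF \<sigma>] by simp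
  have "is_D_loss \<sigma> v (\<lambda>z. lim (\<lambda>j. trig_poly (evolve (- \<alpha>) t (damped \<sigma> \<phi>)) (F j) z))"
    unfolding is_D_loss_iff
  proof (intro conjI allI Riesz_Fischer(1)[OF F c])
    fix n
    have "tcoeff v n = evolve (- \<alpha>) t (tcoeff \<phi>) n" using v by (simp only: is_S_flow_iff)
    then show "tcoeff (\<lambda>z. lim (\<lambda>j. trig_poly (evolve (- \<alpha>) t (damped \<sigma> \<phi>)) (F j) z)) n
        = of_real (size1 n powr - \<sigma>) * tcoeff v n"
      unfolding Riesz_Fischer(2)[OF F c] by (simp add: evolve_def damped_def)
  qed
  then show "\<exists>v. is_S_flow \<alpha> t \<phi> v \<and> is_D_loss \<sigma> v
      (\<lambda>z. lim (\<lambda>j. trig_poly (evolve (- \<alpha>) (fst (t, z)) (damped \<sigma> \<phi>)) (F j) (snd (t, z))))"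
    using v by auto
qed

text \<open>A slice of \<open>u\<close> has the same Fourier coefficients as the limit of the
  partial sums, so uniqueness makes them agree almost everywhere.\<close>

lemma representative_AE_limit:
  assumes F: "geometric_exhaustion (tcoeff \<phi>) F" and \<sigma>: "\<sigma> \<ge> 0"
    and u: "represents_D_loss_S_flow \<sigma> \<alpha> I \<phi> u" and t: "t \<in> I"
  shows "AE z in torus2. (\<lambda>j. trig_poly (evolve (- \<alpha>) t (damped \<sigma> \<phi>)) (F j) z) \<longlonglongrightarrow> u (t, z)"
proof -
  let ?c = "evolve (- \<alpha>) t (damped \<sigma> \<phi>)"
  define f where "f z = lim (\<lambda>j. trig_poly ?c (F j) z)" for z
  have c: "norm (?c n) \<le> norm (tcoeff \<phi> n)" for n using norm_damped_le[OF \<sigma>] by simp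
  note RF = Riesz_Fischer[OF F, of ?c, OF c, folded f_def]
  obtain v where v: "is_S_flow \<alpha> t \<phi> v" "is_D_loss \<sigma> v (\<lambda>z. u (t, z))"
    using u t by (auto simp: represents_D_loss_S_flow_def)
  have int: "integrable torus2 f" "integrable torus2 (\<lambda>z. u (t, z))"
    using RF(1) v(2) by (auto simp: is_D_loss_iff Lp_space_2_integrable)
  have "AE z in torus2. f z - u (t, z) = 0"
  proof (rule fourier_uniqueness)
    show "tcoeff (\<lambda>z. f z - u (t, z)) n = 0" for n
      using tcoeff_diff[OF int] tcoeff_of_representative[OF v] RF(2) by simp
  qed (use int in simp)
  with RF(3) show ?thesis by eventually_elim simp
qed

text \<open>The exceptional null set depends on t, so \<open>u\<close> is identified with the limit
  slice by slice and carried to space-time by iterated integration; there Fatou applies to the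
  jointly measurable partial sums.\<close>

lemma nn_integral_representative_le:
  assumes F: "geometric_exhaustion (tcoeff \<phi>) F" and \<sigma>: "\<sigma> \<ge> 0" and I: "I \<in> sets borel"
    and u: "represents_D_loss_S_flow \<sigma> \<alpha> I \<phi> u"
    and B: "\<And>j. (\<integral>\<^sup>+p. ennreal (norm (trig_poly (evolve (- \<alpha>) (fst p) (damped \<sigma> \<phi>)) (F j) (snd p)) ^ 4)
      \<partial>spacetime I) \<le> B"
  shows "(\<integral>\<^sup>+p. ennreal (norm (u p) ^ 4) \<partial>spacetime I) \<le> B"
proof -
  let ?h = "\<lambda>j p. ennreal (norm (trig_poly (evolve (- \<alpha>) (fst p) (damped \<sigma> \<phi>)) (F j) (snd p)) ^ 4)"
  have um [measurable]: "u \<in> borel_measurable (spacetime I)"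
    using u by (simp add: represents_D_loss_S_flow_def)
  have hm: "?h j \<in> borel_measurable (spacetime I)" for j
    by (rule norm_power4_trig_poly_evolve_measurable)
  have lm: "(\<lambda>p. liminf (\<lambda>j. ?h j p)) \<in> borel_measurable (spacetime I)"
    by (intro borel_measurable_liminf hm)
  have um4: "(\<lambda>p. ennreal (norm (u p) ^ 4)) \<in> borel_measurable (spacetime I)"
    by measurable
  have "(\<integral>\<^sup>+z. ennreal (norm (u (t, z)) ^ 4) \<partial>torus2) = (\<integral>\<^sup>+z. liminf (\<lambda>j. ?h j (t, z)) \<partial>torus2)"
    if "t \<in> I" for t
  proof (rule nn_integral_cong_AE)
    show "AE z in torus2. ennreal (norm (u (t, z)) ^ 4) = liminf (\<lambda>j. ?h j (t, z))"
      using representative_AE_limit[OF F \<sigma> u that]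
    proof eventually_elim
      case (elim z)
      then have "(\<lambda>j. ?h j (t, z)) \<longlonglongrightarrow> ennreal (norm (u (t, z)) ^ 4)"
        unfolding fst_conv snd_conv by (intro tendsto_ennrealI tendsto_intros)
      from lim_imp_Liminf[OF _ this] show ?case by simp
    qed
  qed
  then have "(\<integral>\<^sup>+p. ennreal (norm (u p) ^ 4) \<partial>spacetime I) = (\<integral>\<^sup>+p. liminf (\<lambda>j. ?h j p) \<partial>spacetime I)"
    unfolding nn_integral_spacetime[OF um4 I] nn_integral_spacetime[OF lm I]
    by (intro nn_integral_cong) (auto simp: indicator_def)
  also have "\<dots> \<le> liminf (\<lambda>j. \<integral>\<^sup>+p. ?h j p \<partial>spacetime I)"
    by (rule nn_integral_liminf[OF hm])
  also have "\<dots> \<le> limsup (\<lambda>j. \<integral>\<^sup>+p. ?h j p \<partial>spacetime I)"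
    by (rule Liminf_le_Limsup) simp
  also have "\<dots> \<le> B"
    by (rule Limsup_bounded) (simp add: B)
  finally show ?thesis .
qed

text \<open>The existence clause keeps the bound over all representatives from being vacuous.
  Membership in L^4 is asserted as well, because the integral of a non-integrable function is 0 by
  convention and the inequality alone would then say nothing.\<close>

theorem proposition2p7:
  fixes \<alpha> \<epsilon> :: real and I :: "real set"
  assumes "\<alpha> < 0"
    and "is_interval I" and "bounded I" and "0 \<in> I"
    and "\<epsilon> > 0"
  shows "\<exists>C>0. \<forall>\<phi>\<in>Lp_space 2 torus2.
    (\<exists>u. represents_D_loss_S_flow (1/8 + \<epsilon>) \<alpha> I \<phi> u) \<and>
    (\<forall>u. represents_D_loss_S_flow (1/8 + \<epsilon>) \<alpha> I \<phi> u \<longrightarrow>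
      u \<in> Lp_space 4 (spacetime I) \<and>
      Lp_norm 4 (spacetime I) u \<le> C * Lp_norm 2 torus2 \<phi>)"
proof -
  have I: "I \<in> sets borel" by (rule real_interval_borel_measurable) fact
  obtain R where R: "R > 0" "I \<subseteq> {-R..R}"
  proof -
    obtain R where "R > 0" "\<forall>x\<in>I. norm x \<le> R" using \<open>bounded I\<close> by (auto simp: bounded_pos)
    then show ?thesis by (intro that[of R]) (auto simp: abs_le_iff)
  qed
  have \<beta>: "- \<alpha> > 0" using \<open>\<alpha> < 0\<close> by simp
  obtain C where C: "C > 0" and strichartz: "\<And>F a. finite F \<Longrightarrow>
      (\<integral>\<^sup>+p. ennreal (norm (trig_poly (evolve (- \<alpha>) (fst p) (\<lambda>n. of_real (size1 n powr - (1/8 + \<epsilon>)) * a n)) F (snd p)) ^ 4) \<partial>spacetime I)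
        \<le> ennreal (C * (\<Sum>n\<in>F. (norm (a n))\<^sup>2)\<^sup>2)"
    using trig_poly_strichartz[OF \<beta> R(1) I R(2) \<open>\<epsilon> > 0\<close>] by blast
  define \<sigma> where "\<sigma> = 1/8 + \<epsilon>"
  have \<sigma>: "\<sigma> \<ge> 0" using \<open>\<epsilon> > 0\<close> by (simp add: \<sigma>_def)
  \<comment> \<open>The fourth root of C S^2, with S the squared L^2 norm of \<open>\<phi>\<close>,
    is C^(1/4) times that norm.\<close>
  define C' where "C' = C powr (1/4)"
  show ?thesis
  proof (intro exI[of _ C'] conjI ballI allI impI)
    show "C' > 0" using C by (simp add: C'_def)
    fix \<phi> assume \<phi>: "\<phi> \<in> Lp_space 2 torus2"
    define S where "S = (LINT z|torus2. (norm (\<phi> z))\<^sup>2)"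
    have S: "S \<ge> 0" by (simp add: S_def)
    have bessel: "(\<Sum>n\<in>F. (norm (tcoeff \<phi> n))\<^sup>2) \<le> S" if "finite F" for F
    proof -
      have "1 \<le> (2 * pi)\<^sup>2" using pi_ge_two by (intro one_le_power) simp
      then have "1 * (\<Sum>n\<in>F. (norm (tcoeff \<phi> n))\<^sup>2) \<le> (2 * pi)\<^sup>2 * (\<Sum>n\<in>F. (norm (tcoeff \<phi> n))\<^sup>2)"
        by (rule mult_right_mono) (simp add: sum_nonneg)
      also have "\<dots> \<le> S" unfolding S_def by (rule Bessel_inequality[OF \<phi> that])
      finally show ?thesis by simp
    qed
    obtain F where F: "geometric_exhaustion (tcoeff \<phi>) F"
      using geometric_exhaustion_exists[OF bessel] by blast
    show "\<exists>u. represents_D_loss_S_flow (1/8 + \<epsilon>) \<alpha> I \<phi> u"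
      using representative_exists[OF F \<sigma>] unfolding \<sigma>_def by blast
    fix u assume u: "represents_D_loss_S_flow (1/8 + \<epsilon>) \<alpha> I \<phi> u"
    have um: "u \<in> borel_measurable (spacetime I)"
      using u by (simp add: represents_D_loss_S_flow_def)
    have le: "(\<integral>\<^sup>+p. ennreal (norm (u p) ^ 4) \<partial>spacetime I) \<le> ennreal (C * S\<^sup>2)"
    proof (rule nn_integral_representative_le[OF F \<sigma> I u[folded \<sigma>_def]])
      fix j
      have fin: "finite (F j)" using F by (simp add: geometric_exhaustion_def)
      have "(\<integral>\<^sup>+p. ennreal (norm (trig_poly (evolve (- \<alpha>) (fst p) (damped \<sigma> \<phi>)) (F j) (snd p)) ^ 4) \<partial>spacetime I)
          \<le> ennreal (C * (\<Sum>n\<in>F j. (norm (tcoeff \<phi> n))\<^sup>2)\<^sup>2)"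
        using strichartz[OF fin, of "tcoeff \<phi>"] by (simp only: damped_def[abs_def] \<sigma>_def)
      also have "\<dots> \<le> ennreal (C * S\<^sup>2)"
        using C by (intro ennreal_leI mult_left_mono power_mono bessel fin sum_nonneg) auto
      finally show "(\<integral>\<^sup>+p. ennreal (norm (trig_poly (evolve (- \<alpha>) (fst p) (damped \<sigma> \<phi>)) (F j) (snd p)) ^ 4) \<partial>spacetime I)
          \<le> ennreal (C * S\<^sup>2)" .
    qed
    have int: "integrable (spacetime I) (\<lambda>p. norm (u p) ^ 4)"
      using um le by (intro integrableI_bounded) (auto simp: le_less_trans[OF _ ennreal_less_top])
    then show "u \<in> Lp_space 4 (spacetime I)"
      using um by (simp add: Lp_space_def)
    have "ennreal (LINT p|spacetime I. norm (u p) ^ 4) \<le> ennreal (C * S\<^sup>2)"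
      using le int by (subst (asm) nn_integral_eq_integral) auto
    then have "(LINT p|spacetime I. norm (u p) ^ 4) \<le> C * S\<^sup>2"
      using C by (subst (asm) ennreal_le_iff) auto
    then have "Lp_norm 4 (spacetime I) u \<le> (C * S\<^sup>2) powr (1/4)"
      unfolding Lp_norm_def by (intro powr_mono2) auto
    also have "\<dots> = C' * (S\<^sup>2) powr (1/4)"
      using C by (simp add: C'_def powr_mult)
    also have "(S\<^sup>2) powr (1/4) = S powr (1/2)"
      using S by (cases "S = 0") (simp_all add: powr_powr flip: powr_numeral)
    also have "S powr (1/2) = Lp_norm 2 torus2 \<phi>"
      by (simp add: S_def Lp_norm_def)
    finally show "Lp_norm 4 (spacetime I) u \<le> C' * Lp_norm 2 torus2 \<phi>" .
  qed
qed

end
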